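(* Let $\mathcal F$ be an oriented topological foliation of $\mathbb{R}^2$, and let $\Gamma_1$ and $\Gamma_2$ be two disjoint oriented topological lines in $\mathbb{R}^2$ that are positively transverse to $\mathcal F$. For any $h\in\mathrm{Str}(\Gamma_1,\Gamma_2)$, any lift $\Theta_{h\mathcal F}$, and any points $x_i,x_i'\in\mathbb{R}^2$ satisfying $x_i\in\Gamma_i$ and $x_i'\in\phi^+_{x_i}\setminus\{x_i\}$ for $i\in\{1,2\}$ (where $\phi_{x_i}$ is the leaf of $\mathcal F$ through $x_i$), the value $$\Theta_{h\mathcal F}(h(x_2),h(x_2'))-\Theta_{h\mathcal F}(h(x_1),h(x_1'))$$ is independent of all such choices, i.e. it is the same integer for every choice of $h\in\mathrm{Str}(\Gamma_1,\Gamma_2)$, every lift $\Theta_{h\mathcal F}$, and all points $x_1\in\Gamma_1$, $x_1'\in\phi^+_{x_1}\setminus\{x_1\}$, $x_2\in\Gamma_2$, $x_2'\in\phi^+_{x_2}\setminus\{x_2\}$.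
   Context: A topological line is the image of a proper topological embedding of $\mathbb{R}$ in $\mathbb{R}^2$; for an oriented line $\lambda$, $L(\lambda)$ and $R(\lambda)$ are the components of $\mathbb{R}^2\setminus\lambda$ on its left and right. Foliations are oriented non-singular topological ($C^0$) foliations of $\mathbb{R}^2$, whose leaves are topological lines. For $z\in\mathbb{R}^2$, $\phi_z$ is the leaf through $z$, and $\phi_z^+$, $\phi_z^-$ are the closed half-leaves starting at $z$, respectively ending at $z$ (both containing $z$). An oriented topological line is positively transverse to $\mathcal F$ if it meets each leaf $\phi$ at most once and always crosses it from $R(\phi)$ to $L(\phi)$. Give $\mathbb{Z}$ the Khalimsky topology, i.e. the coarsest topology in which all sets $\{2k+1\}$ and $\{2k-1,2k,2k+1\}$, $k\in\mathbb{Z}$, are open, and give $\mathbb{Z}/4\mathbb{Z}$ the quotient topology. Let $\Delta$ be the diagonal of $\mathbb{R}^2\times\mathbb{R}^2$. For an oriented foliation $\mathcal F$ and $(z,z')\in\mathbb{R}^2\times\mathbb{R}^2\setminus\Delta$, set $\dot\theta(z,z',\mathcal F)=\dot0,\dot1,\dot2,-\dot1$ according to whether $z'\in\phi_z^+$, $z'\in L(\phi_z)$, $z'\in\phi_z^-$, $z'\in R(\phi_z)$, respectively. Let $\mathcal H$ be the foliation by horizontal lines oriented in the positive $x$-direction; $\dot\theta(\cdot,\cdot,\mathcal H)$ is continuous on $\mathbb{R}^2\times\mathbb{R}^2\setminus\Delta$. For an oriented foliation $\mathcal G$ of $\mathbb{R}^2$, let $W_{\mathcal G}=\{(z,z')\in\mathbb{R}^2\times\mathbb{R}^2: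 z'\in\phi_z^+,\ z'\ne z\}$ (with $\phi_z$ the leaf of $\mathcal G$ through $z$). This set is homeomorphic to $\mathbb{R}^2\times(0,\infty)$, hence simply connected, and a lift $\Theta_{\mathcal G}:W_{\mathcal G}\to\mathbb{Z}$ means a continuous map whose reduction mod $4$ equals $\dot\theta(\cdot,\cdot,\mathcal H)|_{W_{\mathcal G}}$; it exists and is unique up to adding an integer multiple of $4$. For an orientation-preserving homeomorphism $h$ of $\mathbb{R}^2$, $h\mathcal F$ denotes the foliation whose leaves are the images under $h$ of the leaves of $\mathcal F$, with the induced orientation. $\mathrm{Str}(\Gamma_1,\Gamma_2)$ is the set of orientation-preserving homeomorphisms $h$ of $\mathbb{R}^2$ with $h(\Gamma_1)=\mathbb{R}\times\{1\}$ and $h(\Gamma_2)=\mathbb{R}\times\{2\}$. *)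

theory Defs
  imports "HOL-Complex_Analysis.Complex_Analysis"
begin

text \<open>
  The plane is the type \<^typ>\<open>complex\<close>, with coordinates \<^const>\<open>Re\<close> and \<^const>\<open>Im\<close>, and
  \<open>\<int>/4\<int>\<close> is the type \<^typ>\<open>4\<close>, with \<^const>\<open>of_int\<close> as reduction modulo 4.
\<close>

text \<open>An oriented line is the set of all its positively oriented parametrizations.\<close>

type_synonym oline = "(real \<Rightarrow> complex) set"

definition oline_of :: "(real \<Rightarrow> complex) \<Rightarrow> oline" where
  "oline_of \<gamma> = {\<gamma> \<circ> s | s :: real \<Rightarrow> real. strict_mono s \<and> surj s}"

definition oriented_line :: "oline \<Rightarrow> bool" where
  "oriented_line l \<longleftrightarrow>
     (\<exists>\<gamma>. embedding_map euclidean euclidean \<gamma> \<and> proper_map euclidean euclidean \<gamma> \<and>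
          l = oline_of \<gamma>)"

definition points :: "oline \<Rightarrow> complex set" where
  "points l = (\<Union>\<gamma>\<in>l. range \<gamma>)"

definition image_line :: "(complex \<Rightarrow> complex) \<Rightarrow> oline \<Rightarrow> oline" where
  "image_line h l = (\<lambda>\<gamma>. h \<circ> \<gamma>) ` l"

definition horizontal_line :: "real \<Rightarrow> oline" where
  "horizontal_line c = oline_of (\<lambda>t. Complex t c)"

text \<open>A homeomorphism of the plane preserves orientation if its local degree is 1.\<close>

definition op_homeo :: "(complex \<Rightarrow> complex) \<Rightarrow> bool" where
  "op_homeo h \<longleftrightarrow>
     homeomorphism UNIV UNIV h (inv h) \<and>
     (\<forall>z. \<forall>r>0. winding_number (h \<circ> circlepath z r) (h z) = 1)"

text \<open>
  By the Schoenflies theorem, every oriented line is carried by some orientation-preserving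
  homeomorphism of the plane to the real axis directed to the right. Its left and right sides
  are the components of its complement carried to the upper and lower half-planes.
\<close>

definition left_side :: "oline \<Rightarrow> complex set" where
  "left_side l = {z. \<exists>g. op_homeo g \<and> image_line g l = horizontal_line 0 \<and> Im (g z) > 0}"

definition right_side :: "oline \<Rightarrow> complex set" where
  "right_side l = {z. \<exists>g. op_homeo g \<and> image_line g l = horizontal_line 0 \<and> Im (g z) < 0}"

text \<open>
  A foliation is the set of its oriented leaves. A foliated chart takes each component of the
  trace of a leaf on the chart domain onto a horizontal line, directed to the right.
\<close>

definition foliated_chart :: "oline set \<Rightarrow> complex set \<Rightarrow> (complex \<Rightarrow> complex) \<Rightarrow> bool" where
  "foliated_chart \<F> U \<psi> \<longleftrightarrow>
     open U \<and> (\<exists>\<psi>'. homeomorphism U UNIV \<psi> \<psi>') \<and>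
     (\<forall>\<phi>\<in>\<F>. \<forall>\<gamma>\<in>\<phi>. \<forall>I\<in>components (\<gamma> -` U).
        (\<exists>c. (\<psi> \<circ> \<gamma>) ` I = {w. Im w = c}) \<and> strict_mono_on I (\<lambda>t. Re (\<psi> (\<gamma> t))))"

definition oriented_foliation :: "oline set \<Rightarrow> bool" where
  "oriented_foliation \<F> \<longleftrightarrow>
     (\<forall>\<phi>\<in>\<F>. oriented_line \<phi>) \<and>
     (\<forall>z. \<exists>!\<phi>. \<phi> \<in> \<F> \<and> z \<in> points \<phi>) \<and>
     (\<forall>z. \<exists>U \<psi>. z \<in> U \<and> foliated_chart \<F> U \<psi>)"

definition leaf :: "oline set \<Rightarrow> complex \<Rightarrow> oline" where
  "leaf \<F> z = (THE \<phi>. \<phi> \<in> \<F> \<and> z \<in> points \<phi>)"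

definition pos_half_leaf :: "oline set \<Rightarrow> complex \<Rightarrow> complex set" where
  "pos_half_leaf \<F> z = {\<gamma> t | \<gamma> s t. \<gamma> \<in> leaf \<F> z \<and> \<gamma> s = z \<and> s \<le> t}"

definition neg_half_leaf :: "oline set \<Rightarrow> complex \<Rightarrow> complex set" where
  "neg_half_leaf \<F> z = {\<gamma> t | \<gamma> s t. \<gamma> \<in> leaf \<F> z \<and> \<gamma> s = z \<and> t \<le> s}"

definition image_foliation :: "(complex \<Rightarrow> complex) \<Rightarrow> oline set \<Rightarrow> oline set" where
  "image_foliation h \<F> = image_line h ` \<F>"

definition horizontal_foliation :: "oline set" where
  "horizontal_foliation = range horizontal_line"

definition positively_transverse :: "oline \<Rightarrow> oline set \<Rightarrow> bool" where
  "positively_transverse \<Gamma> \<F> \<longleftrightarrow>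
     (\<forall>\<phi>\<in>\<F>.
        (\<forall>p q. p \<in> points \<Gamma> \<inter> points \<phi> \<and> q \<in> points \<Gamma> \<inter> points \<phi> \<longrightarrow> p = q) \<and>
        (\<forall>\<gamma>\<in>\<Gamma>. \<forall>t. \<gamma> t \<in> points \<phi> \<longrightarrow>
           (\<forall>\<^sub>F s in at_left t. \<gamma> s \<in> right_side \<phi>) \<and>
           (\<forall>\<^sub>F s in at_right t. \<gamma> s \<in> left_side \<phi>)))"

definition khalimsky :: "int topology" where
  "khalimsky = topology_generated_by
     (range (\<lambda>k. {2 * k + 1}) \<union> range (\<lambda>k. {2 * k - 1, 2 * k, 2 * k + 1}))"

text \<open>
  Only meaningful for \<open>z \<noteq> z'\<close>, where the four cases are exclusive and exhaustive for a foliation.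
\<close>

definition dot_theta :: "complex \<Rightarrow> complex \<Rightarrow> oline set \<Rightarrow> 4" where
  "dot_theta z z' \<F> =
     (if z' \<in> pos_half_leaf \<F> z then 0
      else if z' \<in> left_side (leaf \<F> z) then 1
      else if z' \<in> neg_half_leaf \<F> z then 2
      else if z' \<in> right_side (leaf \<F> z) then - 1
      else undefined)"

definition W :: "oline set \<Rightarrow> (complex \<times> complex) set" where
  "W \<G> = {(z, z'). z' \<in> pos_half_leaf \<G> z \<and> z' \<noteq> z}"

definition is_lift :: "oline set \<Rightarrow> (complex \<times> complex \<Rightarrow> int) \<Rightarrow> bool" where
  "is_lift \<G> \<Theta> \<longleftrightarrow>
     continuous_map (top_of_set (W \<G>)) khalimsky \<Theta> \<and>
     (\<forall>(z, z')\<in>W \<G>. of_int (\<Theta> (z, z')) = dot_theta z z' horizontal_foliation)"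

definition Str :: "oline \<Rightarrow> oline \<Rightarrow> (complex \<Rightarrow> complex) set" where
  "Str \<Gamma>\<^sub>1 \<Gamma>\<^sub>2 =
     {h. op_homeo h \<and> h ` points \<Gamma>\<^sub>1 = {z. Im z = 1} \<and> h ` points \<Gamma>\<^sub>2 = {z. Im z = 2}}"

end

theory Submission imports Defs begin

text \<open>
  A lift \<open>\<Theta>\<close> along \<open>h\<close> is a discretized continuous argument of \<open>h z' - h z\<close> over the pairs
  \<open>(z, z')\<close> with \<open>z'\<close> ahead of \<open>z\<close> on its leaf. For two straightenings \<open>h\<close>, \<open>h'\<close> and
  \<open>k = h' \<circ> inv h\<close>, the quotient \<open>(k q - k p) / (q - p)\<close> has a continuous logarithm \<open>D\<close> on the whole
  space of pairs of distinct points, because \<open>k\<close> has local degree 1. As the set of pairs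
  \<open>(z, z')\<close> is connected, the two arguments differ by the imaginary part of \<open>D\<close> up to one constant.
  Since \<open>k\<close> preserves both straightened lines and their sides, \<open>D\<close> stays within \<open>\<pi>\<close> of one and
  the same multiple of \<open>2\<pi>\<close> at all pairs starting on either line.
\<close>

section \<open>Continuous logarithms and ratios of displacements\<close>

text \<open>The difference of two logarithms of one function takes values in the discrete set of
  integer multiples of \<open>2 * pi * \<i>\<close>, so it is constant on a connected set.\<close>

lemma continuous_logs_differ_by_constant:
  fixes f g :: "'a::topological_space \<Rightarrow> complex"
  assumes "connected S" "continuous_on S f" "continuous_on S g"
    and "\<And>x. x \<in> S \<Longrightarrow> exp (f x) = exp (g x)"
  obtains m :: int where "\<And>x. x \<in> S \<Longrightarrow> f x = g x + 2 * pi * m * \<i>"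
proof -
  have ex: "\<exists>m::int. f x - g x = 2 * pi * m * \<i>" if "x \<in> S" for x
    using assms(4)[OF that] unfolding exp_eq by (auto simp: algebra_simps)
  have "(\<lambda>x. f x - g x) constant_on S"
  proof (rule continuous_discrete_range_constant[OF assms(1)])
    show "continuous_on S (\<lambda>x. f x - g x)"
      using assms by (intro continuous_intros)
    fix x assume "x \<in> S"
    show "\<exists>e>0. \<forall>y. y \<in> S \<and> f y - g y \<noteq> f x - g x \<longrightarrow> e \<le> norm ((f y - g y) - (f x - g x))"
    proof (intro exI[of _ "2 * pi"] conjI allI impI)
      fix y assume y: "y \<in> S \<and> f y - g y \<noteq> f x - g x"
      obtain m n :: int where mn: "f x - g x = 2 * pi * m * \<i>" "f y - g y = 2 * pi * n * \<i>"
        using ex \<open>x \<in> S\<close> y by meson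
      then have "n \<noteq> m" using y by auto
      have eq: "(f y - g y) - (f x - g x) = of_real (2 * pi * real_of_int (n - m)) * \<i>"
        unfolding mn by (simp add: algebra_simps)
      have "norm ((f y - g y) - (f x - g x)) = 2 * pi * \<bar>real_of_int (n - m)\<bar>"
        unfolding eq norm_mult norm_of_real abs_mult by simp
      moreover have "1 \<le> \<bar>real_of_int (n - m)\<bar>" using \<open>n \<noteq> m\<close> by linarith
      ultimately show "2 * pi \<le> norm ((f y - g y) - (f x - g x))"
        by simp
    qed simp
  qed
  then obtain c where c: "\<And>x. x \<in> S \<Longrightarrow> f x - g x = c" unfolding constant_on_def by blast
  show ?thesis
  proof (cases "S = {}")
    case False
    then obtain x m where "x \<in> S" "f x - g x = 2 * pi * of_int m * \<i>" using ex by blast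
    with c have "\<And>y. y \<in> S \<Longrightarrow> f y = g y + 2 * pi * m * \<i>" by (metis add.commute diff_add_cancel)
    then show ?thesis by (rule that)
  qed (use that in auto)
qed

text \<open>The additive constant cancels in the increment. This lets an explicit logarithm along a
  path be measured against any other one, such as the one that computes a winding number.\<close>

lemma continuous_logs_same_increment:
  fixes f g :: "real \<Rightarrow> complex"
  assumes "continuous_on {a..b} f" "continuous_on {a..b} g" "a \<le> b"
    and "\<And>t. t \<in> {a..b} \<Longrightarrow> exp (f t) = exp (g t)"
  shows "f b - f a = g b - g a"
  by (rule continuous_logs_differ_by_constant[OF _ assms(1,2,4)]) (use \<open>a \<le> b\<close> in auto)

text \<open>\<open>D\<close> is a single-valued branch of log ((k q - k p) / (q - p)) on the
  configuration space of ordered pairs of distinct points. That space has the homotopy type of a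
  circle, so such a branch records that \<open>k\<close> keeps the winding of a circle around its
  centre.\<close>

definition ratio_log :: "(complex \<Rightarrow> complex) \<Rightarrow> (complex \<times> complex \<Rightarrow> complex) \<Rightarrow> bool" where
  "ratio_log k D \<longleftrightarrow> continuous_on {(p, q). p \<noteq> q} D \<and>
     (\<forall>p q. p \<noteq> q \<longrightarrow> k q - k p = (q - p) * exp (D (p, q)))"

lemma ratio_log_continuous:
  assumes "ratio_log k D" "continuous_on S a" "continuous_on S b" "\<And>x. x \<in> S \<Longrightarrow> a x \<noteq> b x"
  shows "continuous_on S (\<lambda>x. D (a x, b x))"
proof (rule continuous_on_compose2[where g = D])
  show "continuous_on {(p, q). p \<noteq> q} D" using assms(1) unfolding ratio_log_def by blast
  show "continuous_on S (\<lambda>x. (a x, b x))" using assms by (intro continuous_intros)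
qed (use assms in auto)

lemma op_homeo_bij: "op_homeo h \<Longrightarrow> bij h"
  unfolding op_homeo_def homeomorphism_def bij_def
  by (metis UNIV_I inj_on_def)

lemma op_homeo_cont: "op_homeo h \<Longrightarrow> continuous_on S h" "op_homeo h \<Longrightarrow> continuous_on S (inv h)"
  unfolding op_homeo_def homeomorphism_def using continuous_on_subset by blast+

text \<open>The map (p, w) to (p, p + exp w) covers the configuration space by a contractible space,
  where the ratio has a logarithm \<open>G\<close>. The deck transformation changes \<open>G\<close>
  by a constant, which vanishes because \<open>h\<close> has local degree 1, so \<open>G\<close>
  descends.\<close>

lemma ratio_log_exists:
  assumes h: "op_homeo h"
  obtains D where "ratio_log h D"
proof -
  have inj: "inj h" using op_homeo_bij[OF h] by (rule bij_is_inj)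
  have cont: "continuous_on UNIV h" using op_homeo_cont[OF h] by blast
  \<comment> \<open>\<open>F\<close> is the ratio in the covering coordinates, with
    \<open>q - p = exp w\<close>.\<close>
  define F where "F = (\<lambda>(z, w). (h (z + exp w) - h z) / exp w)"
  have "continuous_on UNIV F" unfolding F_def case_prod_unfold
    by (intro continuous_intros continuous_on_compose2[OF cont]) auto
  moreover have "F x \<noteq> 0" for x
    using inj by (auto simp: F_def case_prod_unfold inj_eq)
  ultimately obtain G where G: "continuous_on UNIV G" "\<And>x. F x = exp (G x)"
    using continuous_logarithm_on_contractible[of UNIV F] contractible_UNIV by (metis UNIV_I)
  \<comment> \<open>\<open>P\<close> generates the deck transformations of the covering.\<close>
  define P where "P = (\<lambda>x::complex\<times>complex. (fst x, snd x + 2 * pi * \<i>))"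
  have contP: "continuous_on UNIV P" unfolding P_def by (intro continuous_intros)
  obtain m :: int where m: "\<And>x. G (P x) = G x + 2 * pi * m * \<i>"
  proof (rule continuous_logs_differ_by_constant[of UNIV "\<lambda>x. G (P x)" G])
    show "continuous_on UNIV (\<lambda>x. G (P x))"
      by (rule continuous_on_compose2[OF G(1) contP]) auto
    show "exp (G (P x)) = exp (G x)" for x
      unfolding G(2)[symmetric] F_def P_def by (simp add: exp_add case_prod_unfold)
  qed (use G connected_UNIV in auto)
  have per: "G (P x) = G x" for x
  proof -
    define c where "c = h \<circ> circlepath 0 1"
    \<comment> \<open>\<open>l\<close> is a logarithm of \<open>c t - h 0\<close> with increment
      \<open>2 * pi * \<i> * (m + 1)\<close>, so winding number 1 forces
      \<open>m = 0\<close>.\<close>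
    define l where "l = (\<lambda>t::real. G (0, 2 * pi * t * \<i>) + 2 * pi * t * \<i>)"
    have w: "winding_number c (h 0) = 1" using h unfolding op_homeo_def c_def by simp
    have pc: "path c" unfolding c_def
      by (rule path_continuous_image) (auto intro: continuous_on_subset[OF cont])
    have e: "c t = h 0 + exp (l t)" for t
    proof -
      have "exp (l t) = F (0, 2 * pi * t * \<i>) * exp (2 * pi * t * \<i>)"
        unfolding l_def by (simp add: exp_add G(2))
      also have "\<dots> = c t - h 0"
        unfolding F_def c_def circlepath by (simp add: mult_ac)
      finally show ?thesis by simp
    qed
    have "h 0 \<notin> path_image c" using e unfolding path_image_def by auto
    from winding_number_as_continuous_log[OF pc this] obtain q where q: "path q"
      "pathfinish q - pathstart q = 2 * of_real pi * \<i> * winding_number c (h 0)"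
      "\<And>t. t \<in> {0..1} \<Longrightarrow> c t = h 0 + exp (q t)" by blast
    have "l 1 - l 0 = q 1 - q 0"
    proof (rule continuous_logs_same_increment)
      show "continuous_on {0..1} l" unfolding l_def
        by (intro continuous_intros continuous_on_compose2[OF G(1)]) auto
      show "exp (l t) = exp (q t)" if "t \<in> {0..1}" for t
        using e q(3) that by (metis add_left_cancel)
    qed (use q in \<open>auto simp: path_def\<close>)
    then have "l 1 - l 0 = 2 * pi * \<i>" using q(2) w by (simp add: pathfinish_def pathstart_def)
    then have "G (P (0, 0)) = G (0, 0)" unfolding l_def P_def by (simp add: algebra_simps)
    with m[of "(0,0)"] have "m = 0" by simp
    with m show ?thesis by simp
  qed
  define D where "D = (\<lambda>(p, q). G (p, Ln (q - p)))"
  \<comment> \<open>\<open>D'\<close> uses a branch of the logarithm of \<open>q - p\<close> cut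
    along the opposite ray. Periodicity of \<open>G\<close> makes it equal to \<open>D\<close>, so
    the two formulas together give continuity across both cuts.\<close>
  define D' where "D' = (\<lambda>(p, q). G (p, Ln (p - q) + pi * \<i>))"
  have D': "D (p, q) = D' (p, q)" if "p \<noteq> q" for p q :: complex
  proof -
    have "p - q \<noteq> 0" "q - p \<noteq> 0" using that by auto
    then consider "Ln (p - q) = Ln (q - p) + \<i> * pi" | "Ln (p - q) = Ln (q - p) - \<i> * pi"
      using Ln_minus[of "q - p"] by (metis minus_diff_eq)
    then show ?thesis
    proof cases
      case 1
      then show ?thesis using per[of "(p, Ln (q - p))"] unfolding D_def D'_def P_def
        by (simp add: algebra_simps)
    next
      case 2
      then show ?thesis unfolding D_def D'_def by (simp add: algebra_simps)
    qed
  qed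
  let ?A = "{(p::complex, q). q - p \<notin> \<real>\<^sub>\<le>\<^sub>0}" and ?B = "{(p::complex, q). p - q \<notin> \<real>\<^sub>\<le>\<^sub>0}"
  have op: "open ?A" "open ?B"
    using open_vimage[OF open_Compl[OF closed_nonpos_Reals_complex], of "\<lambda>x. snd x - fst x"]
      open_vimage[OF open_Compl[OF closed_nonpos_Reals_complex], of "\<lambda>x. fst x - snd x"]
    by (simp_all add: vimage_def case_prod_unfold
          continuous_on_diff continuous_on_fst continuous_on_snd continuous_on_id)
  have cA: "continuous_on ?A D" unfolding D_def case_prod_unfold
    by (intro continuous_intros continuous_on_compose2[OF G(1)]) (auto simp: case_prod_unfold)
  have "continuous_on ?B D'" unfolding D'_def case_prod_unfold
    by (intro continuous_intros continuous_on_compose2[OF G(1)]) (auto simp: case_prod_unfold)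
  then have cB: "continuous_on ?B D" by (rule continuous_on_eq) (clarify, rule D'[symmetric], auto)
  have "?A \<union> ?B = {(p, q). p \<noteq> q}"
    by (auto simp: complex_nonpos_Reals_iff complex_eq_iff)
  then have "continuous_on {(p, q). p \<noteq> q} D"
    using continuous_on_open_Un[OF op cA cB] by simp
  moreover have "h q - h p = (q - p) * exp (D (p, q))" if "p \<noteq> q" for p q
    using that G(2)[of "(p, Ln (q - p))", symmetric] unfolding D_def F_def by simp
  ultimately have "ratio_log h D" unfolding ratio_log_def by blast
  then show ?thesis by (rule that)
qed

text \<open>Ratios obey a chain rule: the ratio for the composite is that for \<open>h'\<close>
  divided by that for \<open>h\<close>, both taken at the preimages under \<open>h\<close>.
  Subtracting logarithms avoids computing a degree for the composite.\<close>

lemma ratio_log_compose_inv: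
  assumes h: "op_homeo h" and h': "op_homeo h'"
  obtains D where "ratio_log (h' \<circ> inv h) D"
proof -
  obtain A B where A: "ratio_log h A" and B: "ratio_log h' B"
    using ratio_log_exists[OF h] ratio_log_exists[OF h'] by metis
  let ?i = "\<lambda>x. (inv h (fst x), inv h (snd x))"
  have inj: "inj (inv h)" and hi: "h (inv h z) = z" for z
    using op_homeo_bij[OF h] by (simp_all add: bij_imp_bij_inv bij_is_inj bij_is_surj surj_f_inv_f)
  have ci: "continuous_on S (inv h)" for S using op_homeo_cont[OF h] by blast
  have "continuous_on {(p, q). p \<noteq> q} (\<lambda>x. C (?i x))" if "ratio_log k C" for k C
    using inj by (intro ratio_log_continuous[OF that] continuous_on_compose2[OF ci] continuous_intros)
      (auto simp: inj_eq)
  then have "continuous_on {(p, q). p \<noteq> q} (\<lambda>x. B (?i x) - A (?i x))"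
    using A B by (intro continuous_intros) 
  moreover have "(h' \<circ> inv h) q - (h' \<circ> inv h) p = (q - p) * exp (B (?i (p, q)) - A (?i (p, q)))"
    if "p \<noteq> q" for p q
  proof -
    have ne: "inv h p \<noteq> inv h q" using that inj by (auto simp: inj_eq)
    have "q - p = (inv h q - inv h p) * exp (A (?i (p, q)))"
      using A ne hi unfolding ratio_log_def by (metis fst_conv snd_conv)
    then show ?thesis using B ne unfolding ratio_log_def by (simp add: exp_diff)
  qed
  ultimately have "ratio_log (h' \<circ> inv h) (\<lambda>x. B (?i x) - A (?i x))"
    unfolding ratio_log_def by blast
  then show ?thesis by (rule that)
qed

section \<open>Planar maps preserving horizontal lines\<close>

text \<open>A nonpositive real quotient would make \<open>w\<close> zero or opposite to
  \<open>u\<close>. The criterion keeps the ratio of a displacement and its image off the cut of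
  \<open>Ln\<close>.\<close>

lemma ratio_avoids_nonpos_Reals:
  fixes u w :: complex
  assumes "Im u > 0 \<and> Im w > 0 \<or> Im u < 0 \<and> Im w < 0 \<or> Im u = 0 \<and> Im w = 0 \<and> Re u * Re w > 0"
  shows "w / u \<notin> \<real>\<^sub>\<le>\<^sub>0"
proof
  assume "w / u \<in> \<real>\<^sub>\<le>\<^sub>0"
  then obtain t where t: "t \<le> 0" "w / u = of_real t" by (auto elim!: nonpos_Reals_cases)
  moreover have "u \<noteq> 0" using assms by auto
  ultimately have "w = of_real t * u" by (simp add: field_simps)
  then have w: "Im w = t * Im u" "Re w = t * Re u" by auto
  have "\<not> (0 < Im u \<and> 0 < t * Im u)" "\<not> (Im u < 0 \<and> t * Im u < 0)" "\<not> (Re u * (t * Re u) > 0)"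
    using \<open>t \<le> 0\<close> by (auto simp: zero_less_mult_iff mult_less_0_iff)
  with assms show False unfolding w by auto
qed

text \<open>
  A map that reverses exactly one of the two directions of a horizontal line and of the normal
  direction looks like a reflection, so the image of a small circle winds the wrong way.
\<close>

lemma no_half_reflection:
  fixes e :: real
  assumes D: "ratio_log k D" and e: "e = 1 \<or> e = -1"
    and up: "\<And>q. Im p < Im q \<Longrightarrow> e * Im (k q - k p) < 0"
    and down: "\<And>q. Im q < Im p \<Longrightarrow> e * Im (k q - k p) > 0"
    and right: "\<And>q. Im q = Im p \<Longrightarrow> Re p < Re q \<Longrightarrow> Im (k q - k p) = 0 \<and> e * Re (k q - k p) > 0"
    and left: "\<And>q. Im q = Im p \<Longrightarrow> Re q < Re p \<Longrightarrow> Im (k q - k p) = 0 \<and> e * Re (k q - k p) < 0"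
  shows False
proof -
  define c where "c = (\<lambda>t::real. p + exp (t * \<i>))"
  \<comment> \<open>The reflection \<open>e * cnj\<close> undoes the reversal made by
    \<open>k\<close>, so \<open>r\<close> compares two directions in a common half-plane or on a
    common ray.\<close>
  define r where "r = (\<lambda>t. e * cnj (k (c t) - k p) / (c t - p))"
  have cp: "c t \<noteq> p" for t unfolding c_def by simp
  have r: "r t \<notin> \<real>\<^sub>\<le>\<^sub>0" for t unfolding r_def
  proof (rule ratio_avoids_nonpos_Reals)
    consider "Im p < Im (c t)" | "Im (c t) < Im p" | "Im (c t) = Im p" "Re p < Re (c t)"
      | "Im (c t) = Im p" "Re (c t) < Re p"
      using cp[of t] by (meson complex_eq_iff linorder_neqE_linordered_idom)
    then show "0 < Im (c t - p) \<and> 0 < Im (e * cnj (k (c t) - k p)) \<or>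
      Im (c t - p) < 0 \<and> Im (e * cnj (k (c t) - k p)) < 0 \<or>
      Im (c t - p) = 0 \<and> Im (e * cnj (k (c t) - k p)) = 0 \<and>
      0 < Re (c t - p) * Re (e * cnj (k (c t) - k p))"
    proof cases
      case 1 then show ?thesis using up[of "c t"] by (simp add: algebra_simps)
    next
      case 2 then show ?thesis using down[of "c t"] by (simp add: algebra_simps)
    next
      case 3 then show ?thesis using right[of "c t"] by (simp add: zero_less_mult_iff)
    next
      case 4 then show ?thesis using left[of "c t"] by (simp add: zero_less_mult_iff)
    qed
  qed
  \<comment> \<open>Both \<open>f\<close> and \<open>g\<close> are logarithms of
    \<open>k (c t) - k p\<close>. Over one turn \<open>f\<close> gains \<open>2 * pi * \<i>\<close>,
    because the \<open>D\<close> term returns to its value, while \<open>g\<close> loses as much,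
    because the \<open>Ln (r t)\<close> term returns to its value.\<close>
  define f where "f = (\<lambda>t. D (p, c t) + t * \<i>)"
  define g where "g = (\<lambda>t. Ln e - t * \<i> + cnj (Ln (r t)))"
  have cc: "continuous_on S c" for S unfolding c_def by (intro continuous_intros)
  have cf: "continuous_on S f" for S
    unfolding f_def using cp[THEN not_sym]
    by (intro continuous_on_add ratio_log_continuous[OF D] cc continuous_intros) auto
  have kc: "k (c t) - k p = exp (f t)" for t
    using D cp[of t] unfolding ratio_log_def f_def by (force simp: exp_add c_def)
  have ckc: "continuous_on S (\<lambda>t. k (c t) - k p)" for S
    unfolding kc by (intro continuous_intros cf)
  have cr: "continuous_on S r" for S
    unfolding r_def using cp by (intro continuous_intros ckc cc) auto
  have cg: "continuous_on S g" for S unfolding g_def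
    using r by (intro continuous_intros cr) auto
  have eg: "exp (f t) = exp (g t)" for t
  proof -
    have "r t \<noteq> 0" using r[of t] by auto
    then have "exp (g t) = e * exp (- (t * \<i>)) * cnj (r t)"
      using e unfolding g_def by (auto simp: exp_add exp_diff exp_minus field_simps simp flip: exp_cnj)
    also have "cnj (r t) = e * (k (c t) - k p) / exp (- (t * \<i>))"
      unfolding r_def c_def by (simp add: exp_cnj)
    finally show ?thesis using e unfolding kc by auto
  qed
  have "f (2 * pi) - f 0 = g (2 * pi) - g 0"
    by (rule continuous_logs_same_increment[OF cf cg _ eg]) simp
  moreover have "c (2 * pi) = c 0" unfolding c_def by simp
  ultimately show False unfolding f_def g_def r_def by (simp add: complex_eq_iff)
qed

text \<open>Each open half-plane is connected and its image misses the target line, so the image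
  stays on one side. Surjectivity prevents both half-planes from landing on the same side.\<close>

lemma half_planes:
  assumes cont: "continuous_on UNIV k" and bij: "bij k"
    and line: "k ` {z. Im z = a} = {z. Im z = b}"
  shows "(\<forall>q. sgn (Im (k q) - b) = sgn (Im q - a)) \<or> (\<forall>q. sgn (Im (k q) - b) = - sgn (Im q - a))"
proof -
  have eq: "Im (k q) = b \<longleftrightarrow> Im q = a" for q
    using inj_image_mem_iff[OF bij_is_inj[OF bij], of q "{z. Im z = a}"] unfolding line by simp
  have side: "(\<forall>q\<in>H. Im (k q) > b) \<or> (\<forall>q\<in>H. Im (k q) < b)"
    if "connected H" "\<And>q. q \<in> H \<Longrightarrow> Im q \<noteq> a" for H
  proof (rule ccontr)
    assume "\<not> ?thesis"
    then obtain p q where pq: "p \<in> H" "q \<in> H" "Im (k p) \<le> b" "b \<le> Im (k q)" by force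
    have "connected ((\<lambda>q. Im (k q)) ` H)"
      by (intro connected_continuous_image that continuous_intros continuous_on_subset[OF cont]) auto
    then have "b \<in> (\<lambda>q. Im (k q)) ` H" using pq by (auto simp: connected_iff_interval)
    then show False using that(2) eq by auto
  qed
  have up: "(\<forall>q\<in>{q. Im q > a}. Im (k q) > b) \<or> (\<forall>q\<in>{q. Im q > a}. Im (k q) < b)"
    by (rule side[OF convex_connected[OF convex_halfspace_Im_gt]]) auto
  have dn: "(\<forall>q\<in>{q. Im q < a}. Im (k q) > b) \<or> (\<forall>q\<in>{q. Im q < a}. Im (k q) < b)"
    by (rule side[OF convex_connected[OF convex_halfspace_Im_lt]]) auto
  \<comment> \<open>One point on each side of the target line; their preimages show that both sides
    are reached.\<close>
  obtain u v where uv: "k u = Complex 0 (b + 1)" "k v = Complex 0 (b - 1)"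
    using bij_is_surj[OF bij] by (metis surjD)
  have "Im u \<noteq> a" "Im v \<noteq> a" using eq[of u] eq[of v] uv by auto
  with up dn uv have "(\<forall>q. Im q > a \<longrightarrow> Im (k q) > b) \<and> (\<forall>q. Im q < a \<longrightarrow> Im (k q) < b) \<or>
      (\<forall>q. Im q > a \<longrightarrow> Im (k q) < b) \<and> (\<forall>q. Im q < a \<longrightarrow> Im (k q) > b)"
    by (smt (verit) complex.sel(2) mem_Collect_eq)
  then show ?thesis
  proof (elim disjE)
    assume *: "(\<forall>q. Im q > a \<longrightarrow> Im (k q) > b) \<and> (\<forall>q. Im q < a \<longrightarrow> Im (k q) < b)"
    have "sgn (Im (k q) - b) = sgn (Im q - a)" for q
      using *[THEN conjunct1, rule_format, of q] *[THEN conjunct2, rule_format, of q] eq[of q]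
      by (cases "Im q" a rule: linorder_cases) auto
    then show ?thesis by blast
  next
    assume *: "(\<forall>q. Im q > a \<longrightarrow> Im (k q) < b) \<and> (\<forall>q. Im q < a \<longrightarrow> Im (k q) > b)"
    have "sgn (Im (k q) - b) = - sgn (Im q - a)" for q
      using *[THEN conjunct1, rule_format, of q] *[THEN conjunct2, rule_format, of q] eq[of q]
      by (cases "Im q" a rule: linorder_cases) auto
    then show ?thesis by blast
  qed
qed

section \<open>Horizontal lines, their sides and the horizontal foliation\<close>

lemma self_mem_oline_of: "\<gamma> \<in> oline_of \<gamma>"
  unfolding oline_of_def by (auto intro!: exI[of _ id] simp: strict_mono_def)

lemma points_oline_of: "points (oline_of \<gamma>) = range \<gamma>"
  using self_mem_oline_of[of \<gamma>] by (auto simp: points_def oline_of_def)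

lemma points_horizontal_line [simp]: "points (horizontal_line c) = {z. Im z = c}"
  unfolding horizontal_line_def points_oline_of
  by (auto intro!: image_eqI[of _ _ "Re _"] complex_eqI)

text \<open>A straightening runs forward along the line, so swapping the sides would reverse the
  normal direction alone. Hence sides defined through an arbitrary straightening are unambiguous for
  horizontal lines.\<close>

lemma sgn_Im_straightening:
  assumes g: "op_homeo g" and line: "image_line g (horizontal_line c) = horizontal_line 0"
  shows "sgn (Im (g z)) = sgn (Im z - c)"
proof -
  have "(\<lambda>t. Complex t c) \<in> horizontal_line c"
    unfolding horizontal_line_def by (rule self_mem_oline_of)
  then have "g \<circ> (\<lambda>t. Complex t c) \<in> horizontal_line 0"
    unfolding line[symmetric] image_line_def by blast
  then obtain s where s: "strict_mono s" "surj s" "g \<circ> (\<lambda>t. Complex t c) = (\<lambda>t. Complex t 0) \<circ> s"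
    unfolding horizontal_line_def oline_of_def by auto
  have gs: "g (Complex t c) = Complex (s t) 0" for t using fun_cong[OF s(3), of t] by simp
  then have gs': "g z = Complex (s (Re z)) 0" if "Im z = c" for z
    using that by (metis complex.collapse)
  have "g ` {z. Im z = c} = {z. Im z = 0}"
  proof safe
    fix w :: complex assume "Im w = 0"
    then have "w = g (Complex (inv s (Re w)) c)"
      using s(2) by (simp add: gs surj_f_inv_f complex_eq_iff)
    then show "w \<in> g ` {z. Im z = c}" by force
  qed (simp add: gs')
  from half_planes[OF op_homeo_cont(1)[OF g] op_homeo_bij[OF g] this]
  show ?thesis
  proof (elim disjE)
    assume r: "\<forall>q. sgn (Im (g q) - 0) = - sgn (Im q - c)"
    obtain D where D: "ratio_log g D" using ratio_log_exists[OF g] .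
    have False
    \<comment> \<open>Here \<open>e = 1\<close>, since \<open>g\<close> keeps the direction of the
      line and would reverse only the normal.\<close>
    proof (rule no_half_reflection[OF D, of 1 "Complex 0 c"])
      show "1 * Im (g q - g (Complex 0 c)) < 0" if "Im (Complex 0 c) < Im q" for q
        using that r[rule_format, of q] by (simp add: gs sgn_if split: if_splits)
      show "1 * Im (g q - g (Complex 0 c)) > 0" if "Im (Complex 0 c) > Im q" for q
        using that r[rule_format, of q] by (simp add: gs sgn_if split: if_splits)
    qed (use s(1) in \<open>auto simp: gs gs' strict_mono_def\<close>)
    then show ?thesis ..
  qed simp
qed

text \<open>A vertical translation works: it carries circles to circles about the image of the
  centre, so every winding number in question is 1.\<close>

lemma horizontal_line_straightening:
  obtains g where "op_homeo g" "image_line g (horizontal_line c) = horizontal_line 0"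
proof
  let ?g = "\<lambda>z. z - c * \<i>"
  have inv: "inv ?g = (\<lambda>z. z + c * \<i>)" by (rule inv_equality) auto
  have "?g \<circ> circlepath z r = circlepath (?g z) r" for z r
    unfolding circlepath by (auto simp: algebra_simps)
  then show "op_homeo ?g" unfolding op_homeo_def inv
    by (auto simp: homeomorphism_def winding_number_circlepath_centre intro!: continuous_intros)
  have *: "?g \<circ> (\<lambda>t. Complex t c) = (\<lambda>t. Complex t 0)" by (auto simp: complex_eq_iff)
  show "image_line ?g (horizontal_line c) = horizontal_line 0"
    unfolding image_line_def horizontal_line_def oline_of_def *[symmetric]
    by (auto simp: comp_assoc image_iff)
qed

text \<open>One straightening exists and all of them agree on signs, which gives both
  inclusions.\<close>

lemma sides_horizontal_line [simp]:
  "left_side (horizontal_line c) = {z. Im z > c}" "right_side (horizontal_line c) = {z. Im z < c}"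
proof -
  obtain g where g: "op_homeo g" "image_line g (horizontal_line c) = horizontal_line 0"
    using horizontal_line_straightening .
  have *: "0 < Im (h z) \<longleftrightarrow> c < Im z" "Im (h z) < 0 \<longleftrightarrow> Im z < c"
    if "op_homeo h" "image_line h (horizontal_line c) = horizontal_line 0" for h z
    using sgn_Im_straightening[OF that, of z] by (auto simp: sgn_if split: if_splits)
  show "left_side (horizontal_line c) = {z. Im z > c}"
    unfolding left_side_def using * g by blast
  show "right_side (horizontal_line c) = {z. Im z < c}"
    unfolding right_side_def using * g by blast
qed

lemma leaf_horizontal_foliation [simp]: "leaf horizontal_foliation z = horizontal_line (Im z)"
  unfolding leaf_def horizontal_foliation_def by (rule the_equality) auto

lemma half_leaf_horizontal_foliation [simp]:
  "pos_half_leaf horizontal_foliation z = {z'. Im z' = Im z \<and> Re z \<le> Re z'}"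
  "neg_half_leaf horizontal_foliation z = {z'. Im z' = Im z \<and> Re z' \<le> Re z}"
proof -
  have mem: "(\<lambda>t. Complex t c) \<in> horizontal_line c" for c
    unfolding horizontal_line_def by (rule self_mem_oline_of)
  have mono: "Re (\<gamma> s) \<le> Re (\<gamma> t) \<and> Im (\<gamma> s) = c" if "\<gamma> \<in> horizontal_line c" "s \<le> t" for c \<gamma> s t
    using that unfolding horizontal_line_def oline_of_def by (auto simp: strict_mono_less_eq)
  have "\<exists>\<gamma> s t. z' = \<gamma> t \<and> \<gamma> \<in> horizontal_line (Im z) \<and> \<gamma> s = z \<and> s \<le> t"
    if "Im z' = Im z" "Re z \<le> Re z'" for z'
    using that mem[of "Im z"]
    by (intro exI[of _ "\<lambda>t. Complex t (Im z)"] exI[of _ "Re z"] exI[of _ "Re z'"])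
      (auto simp: complex_eq_iff)
  then show "pos_half_leaf horizontal_foliation z = {z'. Im z' = Im z \<and> Re z \<le> Re z'}"
    unfolding pos_half_leaf_def leaf_horizontal_foliation
    by (intro subset_antisym subsetI) (clarify, use mono in blast, blast)
  have "\<exists>\<gamma> s t. z' = \<gamma> t \<and> \<gamma> \<in> horizontal_line (Im z) \<and> \<gamma> s = z \<and> t \<le> s"
    if "Im z' = Im z" "Re z' \<le> Re z" for z'
    using that mem[of "Im z"]
    by (intro exI[of _ "\<lambda>t. Complex t (Im z)"] exI[of _ "Re z"] exI[of _ "Re z'"])
      (auto simp: complex_eq_iff)
  then show "neg_half_leaf horizontal_foliation z = {z'. Im z' = Im z \<and> Re z' \<le> Re z}"
    unfolding neg_half_leaf_def leaf_horizontal_foliation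
    by (intro subset_antisym subsetI) (clarify, use mono in blast, blast)
qed

lemma dot_theta_horizontal_foliation:
  "dot_theta z z' horizontal_foliation =
     (if Im z' > Im z then 1 else if Im z' < Im z then - 1 else if Re z \<le> Re z' then 0 else 2)"
  unfolding dot_theta_def by auto

lemma of_int_eq_mod_4: "(of_int m :: 4) = of_int n \<longleftrightarrow> 4 dvd m - n"
proof -
  have "(of_int m :: 4) = of_int n \<longleftrightarrow> (of_int (m - n) :: 4) = 0" by simp
  also have "\<dots> \<longleftrightarrow> 4 dvd m - n" by (subst of_int_eq_0_iff_char_dvd) simp
  finally show ?thesis .
qed

section \<open>Leaves and the connectedness of the space of forward pairs\<close>

lemma oriented_line_param:
  assumes "oriented_line l"
  obtains \<gamma> where "l = oline_of \<gamma>" "continuous_on UNIV \<gamma>" "inj \<gamma>"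
proof -
  obtain \<gamma> where \<gamma>: "embedding_map euclidean euclidean \<gamma>" "l = oline_of \<gamma>"
    using assms unfolding oriented_line_def by blast
  then have "homeomorphic_map euclidean (top_of_set (range \<gamma>)) \<gamma>"
    unfolding embedding_map_def by simp
  then have "continuous_map euclidean (top_of_set (range \<gamma>)) \<gamma>" "inj \<gamma>"
    using homeomorphic_imp_continuous_map homeomorphic_imp_injective_map by fastforce+
  then show ?thesis using that \<gamma>(2) by (simp add: continuous_map_in_subtopology)
qed

lemma connected_points: "oriented_line l \<Longrightarrow> connected (points l)"
  by (metis connected_UNIV connected_continuous_image oriented_line_param points_oline_of)

lemma leaf_mem:
  assumes "oriented_foliation \<F>"
  shows "leaf \<F> z \<in> \<F>" "z \<in> points (leaf \<F> z)"
  using theI'[of "\<lambda>\<phi>. \<phi> \<in> \<F> \<and> z \<in> points \<phi>"] assms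
  unfolding leaf_def oriented_foliation_def by blast+

lemma leaf_eqI:
  assumes "oriented_foliation \<F>" "\<phi> \<in> \<F>" "z \<in> points \<phi>"
  shows "leaf \<F> z = \<phi>"
  using leaf_mem[OF assms(1), of z] assms unfolding oriented_foliation_def by blast

text \<open>Positive parametrizations of a leaf differ by increasing maps, so the half-leaf can be
  read off from a single one. It exhibits the fibre of \<open>W\<close> over \<open>z\<close> as the
  image of an open ray, hence nonempty and connected.\<close>

lemma leaf_param:
  assumes F: "oriented_foliation \<F>"
  obtains \<gamma> s where "leaf \<F> z = oline_of \<gamma>" "continuous_on UNIV \<gamma>" "inj \<gamma>" "\<gamma> s = z"
    "{z'. (z, z') \<in> W \<F>} = \<gamma> ` {s<..}"
proof -
  have "oriented_line (leaf \<F> z)"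
    using F leaf_mem(1)[OF F] unfolding oriented_foliation_def by blast
  then obtain \<gamma> where \<gamma>: "leaf \<F> z = oline_of \<gamma>" "continuous_on UNIV \<gamma>" "inj \<gamma>"
    using oriented_line_param by metis
  then obtain s where s: "\<gamma> s = z"
    using leaf_mem(2)[OF F, of z] points_oline_of by auto
  have "pos_half_leaf \<F> z = \<gamma> ` {s..}"
  proof (intro subset_antisym subsetI)
    fix z' assume "z' \<in> pos_half_leaf \<F> z"
    then obtain \<sigma> :: "real \<Rightarrow> real" and a t where
      *: "strict_mono \<sigma>" "z' = \<gamma> (\<sigma> t)" "\<gamma> (\<sigma> a) = z" "a \<le> t"
      unfolding pos_half_leaf_def \<gamma>(1) oline_of_def by auto
    then have "\<sigma> a = s" using s \<gamma>(3) by (metis injD)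
    with * show "z' \<in> \<gamma> ` {s..}" by (auto simp: strict_mono_less_eq)
  next
    fix z' assume "z' \<in> \<gamma> ` {s..}"
    then show "z' \<in> pos_half_leaf \<F> z"
      unfolding pos_half_leaf_def \<gamma>(1) using self_mem_oline_of s by auto
  qed
  then have "{z'. (z, z') \<in> W \<F>} = \<gamma> ` {s..} - {\<gamma> s}" unfolding W_def s by auto
  also have "\<dots> = \<gamma> ` {s<..}"
    using \<gamma>(3) by (force simp: inj_eq)
  finally show ?thesis using that \<gamma> s by blast
qed

text \<open>In a foliated chart, moving one unit to the right stays in the chart, since its image is
  the whole plane, and moves forward along the leaf.\<close>

lemma W_local_section:
  assumes F: "oriented_foliation \<F>"
  obtains U \<sigma> where "open U" "z \<in> U" "continuous_on U \<sigma>" "\<And>y. y \<in> U \<Longrightarrow> (y, \<sigma> y) \<in> W \<F>"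
proof -
  obtain U \<psi> where U: "z \<in> U" "foliated_chart \<F> U \<psi>"
    using F unfolding oriented_foliation_def by blast
  from U(2) have "open U" and ex: "\<exists>\<psi>'. homeomorphism U UNIV \<psi> \<psi>'"
    and chart: "\<forall>\<phi>\<in>\<F>. \<forall>\<gamma>\<in>\<phi>. \<forall>I\<in>components (\<gamma> -` U).
        (\<exists>c. (\<psi> \<circ> \<gamma>) ` I = {w. Im w = c}) \<and> strict_mono_on I (\<lambda>t. Re (\<psi> (\<gamma> t)))"
    unfolding foliated_chart_def by - (elim conjE, assumption)+
  from ex obtain \<psi>' where \<psi>': "homeomorphism U UNIV \<psi> \<psi>'" ..
  define \<sigma> where "\<sigma> = (\<lambda>y. \<psi>' (\<psi> y + 1))"
  have cont: "continuous_on U \<psi>" "continuous_on UNIV \<psi>'" and inv: "\<And>x. x \<in> U \<Longrightarrow> \<psi>' (\<psi> x) = x"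
    using \<psi>' unfolding homeomorphism_def by auto
  have "(y, \<sigma> y) \<in> W \<F>" if "y \<in> U" for y
  proof -
    obtain \<gamma> s where \<gamma>: "leaf \<F> y = oline_of \<gamma>" "continuous_on UNIV \<gamma>" "inj \<gamma>" "\<gamma> s = y"
        "{z'. (y, z') \<in> W \<F>} = \<gamma> ` {s<..}"
      by (rule leaf_param[OF F, of y])
    have "s \<in> \<gamma> -` U" using \<gamma>(4) that by simp
    then obtain I where I: "I \<in> components (\<gamma> -` U)" "s \<in> I"
      by (metis Union_components UnionE)
    have "\<gamma> \<in> leaf \<F> y" using \<gamma>(1) self_mem_oline_of by simp
    then obtain c where c: "(\<psi> \<circ> \<gamma>) ` I = {w. Im w = c}" "strict_mono_on I (\<lambda>t. Re (\<psi> (\<gamma> t)))"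
      using chart[rule_format, OF leaf_mem(1)[OF F] _ I(1)] by blast
    have "\<psi> y \<in> (\<psi> \<circ> \<gamma>) ` I" using I(2) \<gamma>(4) by auto
    \<comment> \<open>Adding 1 keeps the imaginary part, and the component of the leaf covers the
      full horizontal line, so the new point lies on the same component.\<close>
    then have "\<psi> y + 1 \<in> (\<psi> \<circ> \<gamma>) ` I" unfolding c by simp
    then obtain t where t: "t \<in> I" "\<psi> (\<gamma> t) = \<psi> y + 1" by auto
    have "\<gamma> t \<in> U" using in_components_subset[OF I(1)] t(1) by auto
    then have "\<sigma> y = \<gamma> t" unfolding \<sigma>_def using t(2) inv by metis
    moreover have "s < t"
    proof (rule ccontr)
      assume "\<not> s < t"
      then have "Re (\<psi> (\<gamma> t)) \<le> Re (\<psi> (\<gamma> s))"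
        using c(2) I(2) t(1) by (cases "t = s") (auto simp: strict_mono_on_def less_le)
      then show False using t(2) \<gamma>(4) by simp
    qed
    ultimately show ?thesis using \<gamma>(5) by blast
  qed
  moreover have "continuous_on U \<sigma>" unfolding \<sigma>_def
    by (rule continuous_on_compose2[OF cont(2)]) (auto intro!: continuous_intros cont)
  ultimately show ?thesis using that \<open>open U\<close> U(1) by blast
qed

lemma connected_openin_cover:
  assumes "connected S" "openin (top_of_set S) A" "openin (top_of_set S) B"
    "S \<subseteq> A \<union> B" "A \<inter> B = {}"
  shows "A = {} \<or> B = {}"
  using assms unfolding connected_openin by meson

text \<open>
  The projection of \<open>W\<close> to its first factor has connected fibres and local sections.
\<close>

lemma connected_W:
  assumes F: "oriented_foliation \<F>" and S: "connected S"
  shows "connected (W \<F> \<inter> S \<times> UNIV)"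
proof (rule ccontr)
  let ?X = "W \<F> \<inter> S \<times> UNIV"
  assume "\<not> connected ?X"
  then obtain A B where AB: "openin (top_of_set ?X) A" "openin (top_of_set ?X) B" "?X \<subseteq> A \<union> B"
    "A \<inter> B = {}" "A \<noteq> {}" "B \<noteq> {}"
    unfolding connected_openin by blast
  have fibre: "connected {z'. (z, z') \<in> W \<F>}" "{z'. (z, z') \<in> W \<F>} \<noteq> {}" for z
  proof -
    obtain \<gamma> s where \<gamma>: "leaf \<F> z = oline_of \<gamma>" "continuous_on UNIV \<gamma>" "inj \<gamma>" "\<gamma> s = z"
        "{z'. (z, z') \<in> W \<F>} = \<gamma> ` {s<..}"
      by (rule leaf_param[OF F, of z])
    then show "connected {z'. (z, z') \<in> W \<F>}" "{z'. (z, z') \<in> W \<F>} \<noteq> {}"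
      unfolding \<gamma>(5) by (auto intro!: connected_continuous_image intro: continuous_on_subset)
  qed
  \<comment> \<open>Fibres are connected, so each piece of a separation contains every fibre that it
    meets.\<close>
  have sat: "(z, b) \<in> C"
    if C: "openin (top_of_set ?X) C" "openin (top_of_set ?X) C'" "?X \<subseteq> C \<union> C'" "C \<inter> C' = {}"
    and "(z, a) \<in> C" "(z, b) \<in> W \<F>" for C C' z a b
  proof (rule ccontr)
    assume "(z, b) \<notin> C"
    let ?f = "\<lambda>z'. (z, z')" and ?Y = "{z'. (z, z') \<in> W \<F>}"
    have z: "z \<in> S" "(z, a) \<in> W \<F>" using openin_imp_subset[OF C(1)] that(5) by auto
    have "(z, b) \<in> C'" using that z \<open>(z, b) \<notin> C\<close> by auto
    have cf: "continuous_on ?Y ?f" "?f \<in> ?Y \<rightarrow> ?X" using z by (auto intro!: continuous_intros)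
    have "openin (top_of_set ?Y) (?Y \<inter> ?f -` C)" "openin (top_of_set ?Y) (?Y \<inter> ?f -` C')"
      using continuous_openin_preimage[OF cf C(1)] continuous_openin_preimage[OF cf C(2)] .
    moreover have "?Y \<subseteq> (?Y \<inter> ?f -` C) \<union> (?Y \<inter> ?f -` C')" using C(3) z by auto
    moreover have "(?Y \<inter> ?f -` C) \<inter> (?Y \<inter> ?f -` C') = {}" using C(4) by auto
    ultimately have "?Y \<inter> ?f -` C = {} \<or> ?Y \<inter> ?f -` C' = {}"
      by (rule connected_openin_cover[OF fibre(1)])
    then show False using that(5,6) z \<open>(z, b) \<in> C'\<close>
      by (metis (no_types, lifting) IntI emptyE mem_Collect_eq vimageI)
  qed
  \<comment> \<open>By saturation \<open>C\<close> contains the value at \<open>z\<close> of a local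
    section. By continuity it contains the nearby values, which project onto a neighbourhood of
    \<open>z\<close> in \<open>S\<close>.\<close>
  have opn: "openin (top_of_set S) (fst ` C)"
    if C: "openin (top_of_set ?X) C" "openin (top_of_set ?X) C'" "?X \<subseteq> C \<union> C'" "C \<inter> C' = {}"
    for C C'
  proof (subst openin_subopen, intro ballI)
    fix z assume "z \<in> fst ` C"
    then obtain a where a: "(z, a) \<in> C" by auto
    then have "z \<in> S" using openin_imp_subset[OF C(1)] by auto
    obtain U \<sigma> where U: "open U" "z \<in> U" "continuous_on U \<sigma>" "\<And>y. y \<in> U \<Longrightarrow> (y, \<sigma> y) \<in> W \<F>"
      using W_local_section[OF F] by metis
    let ?T = "(S \<inter> U) \<inter> (\<lambda>y. (y, \<sigma> y)) -` C"
    have "openin (top_of_set (S \<inter> U)) ?T"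
      by (rule continuous_openin_preimage[OF _ _ C(1)])
        (auto intro!: continuous_intros continuous_on_subset[OF U(3)] U(4))
    moreover have "openin (top_of_set S) (S \<inter> U)" using U(1) by auto
    ultimately have "openin (top_of_set S) ?T" by (rule openin_trans)
    moreover have "z \<in> ?T" using sat[OF C a U(4)[OF U(2)]] U(2) \<open>z \<in> S\<close> by auto
    moreover have "?T \<subseteq> fst ` C" by force
    ultimately show "\<exists>T. openin (top_of_set S) T \<and> z \<in> T \<and> T \<subseteq> fst ` C" by blast
  qed
  have "openin (top_of_set S) (fst ` A)" "openin (top_of_set S) (fst ` B)"
    using opn[OF AB(1-4)] opn[OF AB(2,1)] AB(3,4) by (simp_all add: Un_commute Int_commute)
  moreover have "S \<subseteq> fst ` A \<union> fst ` B"
  proof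
    fix z assume "z \<in> S"
    moreover obtain a where "(z, a) \<in> W \<F>" using fibre(2)[of z] by blast
    ultimately have "(z, a) \<in> A \<union> B" using AB(3) by blast
    then show "z \<in> fst ` A \<union> fst ` B" by force
  qed
  moreover have "fst ` A \<inter> fst ` B = {}"
  proof -
    have False if "(z, a) \<in> A" "(z, b) \<in> B" for z a b
    proof -
      have "(z, b) \<in> A"
        using sat[OF AB(1-4) that(1)] openin_imp_subset[OF AB(2)] that(2) by blast
      then show False using that(2) AB(4) by blast
    qed
    then show ?thesis by auto
  qed
  ultimately have "fst ` A = {} \<or> fst ` B = {}" by (rule connected_openin_cover[OF S])
  then show False using AB(5,6) by simp
qed

text \<open>By injectivity the only image leaf through \<open>h z\<close> is the image of the leaf
  through \<open>z\<close>, and its parametrizations are carried along in order.\<close>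

lemma W_image_foliation:
  assumes F: "oriented_foliation \<F>" and h: "inj h" and W: "(z, z') \<in> W \<F>"
  shows "(h z, h z') \<in> W (image_foliation h \<F>)"
proof -
  have pts: "points (image_line h l) = h ` points l" for l
    unfolding points_def image_line_def by auto
  have "leaf (image_foliation h \<F>) (h z) = image_line h (leaf \<F> z)"
    unfolding leaf_def[of "image_foliation h \<F>"] unfolding image_foliation_def
  proof (rule the_equality)
    show "image_line h (leaf \<F> z) \<in> image_line h ` \<F> \<and> h z \<in> points (image_line h (leaf \<F> z))"
      using leaf_mem[OF F] unfolding pts by blast
    fix \<phi> assume "\<phi> \<in> image_line h ` \<F> \<and> h z \<in> points \<phi>"
    then obtain \<psi> where "\<psi> \<in> \<F>" "\<phi> = image_line h \<psi>" "z \<in> points \<psi>"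
      using h by (auto simp: pts inj_image_mem_iff)
    then show "\<phi> = image_line h (leaf \<F> z)" using leaf_eqI[OF F] by blast
  qed
  then show ?thesis using W h unfolding W_def pos_half_leaf_def image_line_def
    by (fastforce simp: inj_eq)
qed

text \<open>The points \<open>z\<close> and \<open>z'\<close> are distinct on one leaf, which a
  transversal meets at most once. This is what makes lifts odd over a straightened
  transversal.\<close>

lemma W_not_on_transversal:
  assumes F: "oriented_foliation \<F>" and "positively_transverse \<Gamma> \<F>"
    and "z \<in> points \<Gamma>" "(z, z') \<in> W \<F>"
  shows "z' \<notin> points \<Gamma>"
proof -
  have "z' \<in> points (leaf \<F> z)" "z' \<noteq> z"
    using assms(4) unfolding W_def pos_half_leaf_def points_def by auto
  then show ?thesis
    using assms leaf_mem[OF F, of z] unfolding positively_transverse_def by blast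
qed

section \<open>Discretized directions and Khalimsky-valued functions\<close>

text \<open>Modulo full turns the angle \<open>n * pi / 2\<close> depends only on \<open>n\<close>
  modulo 4. Odd residues are the classes of the open upper and lower half-planes, even ones those of
  the two horizontal rays. The half-plane form of the first claim is what the choice of a logarithm
  branch requires.\<close>

lemma dot_theta_cell:
  assumes n: "of_int n = dot_theta p q horizontal_foliation" and pq: "p \<noteq> q"
  shows "Re ((q - p) * cis (- (n * pi / 2))) > 0" and "odd n \<longleftrightarrow> Im p \<noteq> Im q"
proof -
  have red: "cis (- (n * pi / 2)) = cis (- (j * pi / 2))" if "4 dvd n - j" for j :: int
  proof -
    obtain m where m: "n = j + 4 * m" using \<open>4 dvd n - j\<close> by (metis add.commute diff_add_cancel dvdE)
    have "cis (- (n * pi / 2)) = cis (- (j * pi / 2)) * cis (2 * pi * real_of_int (- m))"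
      unfolding m cis_mult by (rule arg_cong[where f = cis]) (simp add: field_simps)
    then show ?thesis by (subst (asm) cis_multiple_2pi) auto
  qed
  have par: "odd n \<longleftrightarrow> odd j" if "4 dvd n - j" for j :: int
    using that by presburger
  have mod: "4 dvd n - j" if "dot_theta p q horizontal_foliation = of_int j" for j :: int
    using n that of_int_eq_mod_4 by metis
  consider "Im q > Im p" | "Im q < Im p" | "Im q = Im p" "Re p < Re q" | "Im q = Im p" "Re q < Re p"
    using pq by (meson complex_eq_iff linorder_neqE_linordered_idom)
  then have "Re ((q - p) * cis (- (n * pi / 2))) > 0 \<and> (odd n \<longleftrightarrow> Im p \<noteq> Im q)"
  proof cases
    case 1
    then have "4 dvd n - 1" by (intro mod) (simp add: dot_theta_horizontal_foliation)
    with 1 show ?thesis by (simp add: red par)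
  next
    case 2
    then have "4 dvd n - (-1)" by (intro mod) (simp add: dot_theta_horizontal_foliation)
    with 2 show ?thesis by (simp only: red par) simp
  next
    case 3
    then have "4 dvd n - 0" by (intro mod) (simp add: dot_theta_horizontal_foliation)
    with 3 show ?thesis by (simp only: red par) simp
  next
    case 4
    then have "4 dvd n - 2" by (intro mod) (simp add: dot_theta_horizontal_foliation)
    with 4 show ?thesis by (simp only: red par) simp
  qed
  then show "Re ((q - p) * cis (- (n * pi / 2))) > 0" "odd n \<longleftrightarrow> Im p \<noteq> Im q" by auto
qed

text \<open>An odd integer is an open point, and an even one has an open neighbourhood made of
  itself and the two adjacent odd integers. Both claims pull these sets back.\<close>

lemma khalimsky_nhd:
  assumes N: "continuous_map (top_of_set X) khalimsky N" and x: "x \<in> X"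
  shows "odd (N x) \<Longrightarrow> \<forall>\<^sub>F y in at x within X. N y = N x"
    and "\<forall>\<^sub>F y in at x within X. \<bar>N y - N x\<bar> \<le> 1"
proof -
  have ev: "\<forall>\<^sub>F y in at x within X. N y \<in> V" if "openin khalimsky V" "N x \<in> V" for V
  proof -
    have "openin (top_of_set X) {y \<in> X. N y \<in> V}"
      using openin_continuous_map_preimage[OF N that(1)] by simp
    then obtain T where "open T" "{y \<in> X. N y \<in> V} = X \<inter> T" unfolding openin_open by blast
    then show ?thesis using x that(2) unfolding eventually_at_topological by blast
  qed
  have o1: "openin khalimsky {2 * k + 1}" and o3: "openin khalimsky {2 * k - 1, 2 * k, 2 * k + 1}" for k
    unfolding khalimsky_def by (auto intro!: topology_generated_by_Basis)
  show odd: "\<forall>\<^sub>F y in at x within X. N y = N x" if "odd (N x)"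
    using that ev[OF o1] by (auto elim!: oddE)
  show "\<forall>\<^sub>F y in at x within X. \<bar>N y - N x\<bar> \<le> 1"
  proof (cases "odd (N x)")
    case True then show ?thesis using odd by (auto elim: eventually_mono)
  next
    case False
    then obtain k where "N x = 2 * k" by auto
    with ev[OF o3, of k] show ?thesis by (auto elim: eventually_mono)
  qed
qed

text \<open>Odd integers are open points, so \<open>N\<close> is locally constant along
  \<open>S\<close>.\<close>

lemma khalimsky_odd_constant:
  assumes N: "continuous_map (top_of_set X) khalimsky N"
    and S: "connected S" "S \<subseteq> X" "\<And>x. x \<in> S \<Longrightarrow> odd (N x)" and "x \<in> S" "y \<in> S"
  shows "N x = N y"
proof -
  have "(\<lambda>x. real_of_int (N x)) constant_on S"
  proof (rule continuous_discrete_range_constant[OF S(1)])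
    have "((\<lambda>x. real_of_int (N x)) \<longlongrightarrow> N x) (at x within S)" if "x \<in> S" for x
    proof (rule tendsto_eventually)
      have "\<forall>\<^sub>F y in at x within X. N y = N x" using khalimsky_nhd(1)[OF N] S that by blast
      then have "\<forall>\<^sub>F y in at x within S. N y = N x" using at_le[OF S(2)] by (auto simp: le_filter_def)
      then show "\<forall>\<^sub>F y in at x within S. real_of_int (N y) = N x" by (rule eventually_mono) simp
    qed
    then show "continuous_on S (\<lambda>x. real_of_int (N x))" unfolding continuous_on_def by blast
    show "\<exists>e>0. \<forall>y. y \<in> S \<and> real_of_int (N y) \<noteq> N x \<longrightarrow> e \<le> norm (real_of_int (N y) - N x)" for x
      by (rule exI[of _ 1]) auto
  qed
  then show ?thesis using assms(5,6) unfolding constant_on_def by (metis of_int_eq_iff)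
qed

text \<open>
  The number \<open>N\<close> names the open half-plane, centred at the direction \<open>\<i>\<^sup>N\<close>, on which the
  branch of the logarithm is taken. Neighbouring branches agree on the common quadrant.
\<close>

lemma khalimsky_log:
  fixes v :: "'a::t2_space \<Rightarrow> complex"
  assumes N: "continuous_map (top_of_set X) khalimsky N" and v: "continuous_on X v"
    and pos: "\<And>x. x \<in> X \<Longrightarrow> Re (v x * cis (- (N x * pi / 2))) > 0"
  obtains A where "continuous_on X A" "\<And>x. x \<in> X \<Longrightarrow> exp (A x) = v x"
    "\<And>x. x \<in> X \<Longrightarrow> \<bar>Im (A x) - N x * pi / 2\<bar> < pi / 2"
proof
  \<comment> \<open>\<open>a n\<close> is the branch of the logarithm on the half-plane around the
    angle \<open>n * pi / 2\<close>, obtained by rotating that half-plane to the right one.\<close>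
  define a where "a = (\<lambda>(n::int) w. of_real (n * pi / 2) * \<i> + Ln (w * cis (- (n * pi / 2))))"
  have step: "a (n + 1) w = a n w"
    if "Re (w * cis (- (n * pi / 2))) > 0" "Re (w * cis (- (of_int (n + 1) * pi / 2))) > 0" for n w
  proof -
    let ?u = "w * cis (- (n * pi / 2))"
    have "?u \<noteq> 0" using that(1) by force
    \<comment> \<open>With this bound, subtracting \<open>pi / 2\<close> keeps the argument within
      the principal range, so \<open>Ln\<close> commutes with the quarter turn.\<close>
    then have "\<bar>Im (Ln ?u)\<bar> < pi / 2" using Re_Ln_pos_lt that(1) by blast
    moreover have "- (of_int (n + 1) * pi / 2) = - (n * pi / 2) + - (pi / 2)"
      by (simp add: field_simps)
    then have "w * cis (- (of_int (n + 1) * pi / 2)) = ?u * cis (- (pi / 2))"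
      by (metis cis_mult mult.assoc)
    moreover have "exp (Ln ?u - of_real (pi / 2) * \<i>) = ?u * cis (- (pi / 2))"
    proof -
      have "cis (- (pi / 2)) = exp (- (of_real (pi / 2) * \<i>))"
        unfolding cis_conv_exp by (simp add: mult.commute)
      then show ?thesis
        using \<open>?u \<noteq> 0\<close> by (metis exp_Ln exp_add uminus_add_conv_diff add.commute)
    qed
    ultimately have "Ln (w * cis (- (of_int (n + 1) * pi / 2))) = Ln ?u - of_real (pi / 2) * \<i>"
      by (intro Ln_unique) auto
    then show ?thesis unfolding a_def by (simp add: algebra_simps add_divide_distrib)
  qed
  define A where "A = (\<lambda>x. a (N x) (v x))"
  have ne: "v x * cis (- (N x * pi / 2)) \<noteq> 0" if "x \<in> X" for x using pos[OF that] by force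
  show "exp (A x) = v x" if "x \<in> X" for x
  proof -
    have "exp (of_real (N x * pi / 2) * \<i>) = cis (N x * pi / 2)"
      unfolding cis_conv_exp by (simp add: mult.commute)
    then have "exp (A x) = v x * (cis (N x * pi / 2) * cis (- (N x * pi / 2)))"
      unfolding A_def a_def exp_add exp_Ln[OF ne[OF that]] by (simp only: mult_ac)
    then show ?thesis unfolding cis_mult by simp
  qed
  show "\<bar>Im (A x) - N x * pi / 2\<bar> < pi / 2" if "x \<in> X" for x
    using Re_Ln_pos_lt[OF ne[OF that]] pos[OF that] by (simp add: A_def a_def)
  have "(A \<longlongrightarrow> A x) (at x within X)" if x: "x \<in> X" for x
  proof -
    have vx: "(v \<longlongrightarrow> v x) (at x within X)" using v x unfolding continuous_on_def by blast
    let ?b = "\<lambda>y. v y * cis (- (N x * pi / 2))"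
    have b: "(?b \<longlongrightarrow> ?b x) (at x within X)" by (intro tendsto_intros vx)
    have "((\<lambda>y. Re (?b y)) \<longlongrightarrow> Re (?b x)) (at x within X)" by (intro tendsto_intros vx)
    then have "\<forall>\<^sub>F y in at x within X. Re (?b y) > 0" using pos[OF x] by (rule order_tendstoD)
    moreover have "\<forall>\<^sub>F y in at x within X. y \<in> X" by (auto simp: eventually_at_filter)
    \<comment> \<open>Near \<open>x\<close> the value of \<open>N\<close> moves by at most one, and
      \<open>step\<close> identifies the branch used there with the one fixed at \<open>x\<close>.
      Continuity of that fixed branch then suffices.\<close>
    ultimately have ev: "\<forall>\<^sub>F y in at x within X. a (N x) (v y) = A y"
      using khalimsky_nhd(2)[OF N x]
    proof eventually_elim
      case (elim y)
      from elim(3) consider "N y = N x" | "N y = N x + 1" | "N x = N y + 1" by linarith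
      then show ?case
      proof cases
        case 2
        then show ?thesis using step[of "v y" "N x"] elim pos[OF elim(2)] by (simp add: A_def)
      next
        case 3
        then show ?thesis using step[of "v y" "N y"] elim pos[OF elim(2)] by (simp add: A_def)
      qed (simp add: A_def)
    qed
    have "?b x \<notin> \<real>\<^sub>\<le>\<^sub>0" using pos[OF x] by (auto simp: complex_nonpos_Reals_iff)
    then have "((\<lambda>y. a (N x) (v y)) \<longlongrightarrow> a (N x) (v x)) (at x within X)"
      unfolding a_def by (intro tendsto_intros vx)
    then have "((\<lambda>y. a (N x) (v y)) \<longlongrightarrow> A x) (at x within X)" unfolding A_def .
    then show ?thesis using ev by (rule Lim_transform_eventually)
  qed
  then show "continuous_on X A" unfolding continuous_on_def by blast
qed

section \<open>Lifts along a straightening\<close>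

text \<open>Lifts for different \<open>h\<close> live on different spaces; composition with
  \<open>h\<close> brings them to the single space \<open>W \<F>\<close>, where they can be
  compared.\<close>

lemma pullback_lift:
  assumes F: "oriented_foliation \<F>" and h: "op_homeo h" and \<Theta>: "is_lift (image_foliation h \<F>) \<Theta>"
  shows "continuous_map (top_of_set (W \<F>)) khalimsky (\<lambda>(z, z'). \<Theta> (h z, h z'))"
    and "\<And>z z'. (z, z') \<in> W \<F> \<Longrightarrow>
      of_int (\<Theta> (h z, h z')) = dot_theta (h z) (h z') horizontal_foliation"
proof -
  let ?f = "\<lambda>x. (h (fst x), h (snd x))"
  have W: "(h z, h z') \<in> W (image_foliation h \<F>)" if "(z, z') \<in> W \<F>" for z z'
    using W_image_foliation[OF F bij_is_inj[OF op_homeo_bij[OF h]] that] .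
  have "continuous_on (W \<F>) ?f"
    by (intro continuous_intros continuous_on_compose2[OF op_homeo_cont(1)[OF h, of UNIV]]) auto
  then have "continuous_map (top_of_set (W \<F>)) (top_of_set (W (image_foliation h \<F>))) ?f"
    using W by (auto simp: continuous_map_in_subtopology)
  moreover have "continuous_map (top_of_set (W (image_foliation h \<F>))) khalimsky \<Theta>"
    using \<Theta> unfolding is_lift_def by blast
  ultimately have "continuous_map (top_of_set (W \<F>)) khalimsky (\<Theta> \<circ> ?f)"
    by (rule continuous_map_compose)
  then show "continuous_map (top_of_set (W \<F>)) khalimsky (\<lambda>(z, z'). \<Theta> (h z, h z'))"
    by (simp add: comp_def case_prod_unfold)
  show "of_int (\<Theta> (h z, h z')) = dot_theta (h z) (h z') horizontal_foliation"
    if "(z, z') \<in> W \<F>" for z z'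
    using \<Theta> W[OF that] unfolding is_lift_def by blast
qed

text \<open>The residue of the lift places \<open>h z' - h z\<close> in the half-plane around the
  angle named by the lift, so the branches chosen by the lift fit together continuously.\<close>

lemma lift_log:
  assumes F: "oriented_foliation \<F>" and h: "op_homeo h" and \<Theta>: "is_lift (image_foliation h \<F>) \<Theta>"
  obtains A where "continuous_on (W \<F>) A"
    "\<forall>(z, z') \<in> W \<F>. exp (A (z, z')) = h z' - h z"
    "\<forall>(z, z') \<in> W \<F>. \<bar>Im (A (z, z')) - \<Theta> (h z, h z') * pi / 2\<bar> < pi / 2"
proof -
  have ne: "h z \<noteq> h z'" if "(z, z') \<in> W \<F>" for z z'
    using that bij_is_inj[OF op_homeo_bij[OF h]] by (auto simp: W_def inj_eq)
  let ?v = "\<lambda>x. h (snd x) - h (fst x)"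
  have "continuous_on (W \<F>) ?v"
    by (intro continuous_intros continuous_on_compose2[OF op_homeo_cont(1)[OF h, of UNIV]]) auto
  moreover have "Re (?v x * cis (- ((case x of (z, z') \<Rightarrow> \<Theta> (h z, h z')) * pi / 2))) > 0"
    if "x \<in> W \<F>" for x
    using dot_theta_cell(1)[OF pullback_lift(2)[OF assms] ne] that by (cases x) auto
  ultimately obtain A where "continuous_on (W \<F>) A" "\<And>x. x \<in> W \<F> \<Longrightarrow> exp (A x) = ?v x"
    "\<And>x. x \<in> W \<F> \<Longrightarrow> \<bar>Im (A x) - (case x of (z, z') \<Rightarrow> \<Theta> (h z, h z')) * pi / 2\<bar> < pi / 2"
    using khalimsky_log[OF pullback_lift(1)[OF assms], of ?v] by blast
  then show ?thesis by (intro that[of A]) auto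
qed

text \<open>A forward point of a leaf leaves the transversal, so its image leaves the horizontal
  line and the lift is odd. The forward pairs based on the transversal form a connected set, on
  which an odd lift is constant.\<close>

lemma lift_constant_on_transversal:
  assumes F: "oriented_foliation \<F>" and h: "op_homeo h" and \<Theta>: "is_lift (image_foliation h \<F>) \<Theta>"
    and \<Gamma>: "oriented_line \<Gamma>" "positively_transverse \<Gamma> \<F>" "h ` points \<Gamma> = {z. Im z = c}"
    and x: "x \<in> points \<Gamma>" "(x, x') \<in> W \<F>" and y: "y \<in> points \<Gamma>" "(y, y') \<in> W \<F>"
  shows "\<Theta> (h x, h x') = \<Theta> (h y, h y')"
proof -
  have "odd (\<Theta> (h z, h z'))" if "z \<in> points \<Gamma>" "(z, z') \<in> W \<F>" for z z'
  proof -
    have "z' \<notin> points \<Gamma>" using W_not_on_transversal[OF F \<Gamma>(2) that] .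
    then have "h z' \<notin> h ` points \<Gamma>"
      using bij_is_inj[OF op_homeo_bij[OF h]] by (simp add: inj_image_mem_iff)
    moreover have "h z \<in> h ` points \<Gamma>" using that(1) by blast
    ultimately have "Im (h z) \<noteq> Im (h z')" unfolding \<Gamma>(3) by auto
    then show ?thesis using dot_theta_cell(2)[OF pullback_lift(2)[OF F h \<Theta> that(2)]] by force
  qed
  then have "(case (x, x') of (z, z') \<Rightarrow> \<Theta> (h z, h z')) = (case (y, y') of (z, z') \<Rightarrow> \<Theta> (h z, h z'))"
    using x y connected_W[OF F connected_points[OF \<Gamma>(1)]]
    by (intro khalimsky_odd_constant[OF pullback_lift(1)[OF F h \<Theta>],
          where S = "W \<F> \<inter> points \<Gamma> \<times> UNIV"]) auto
  then show ?thesis by simp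
qed

section \<open>Comparison of two straightenings\<close>

text \<open>A continuous injection of the real line is monotone. If it were decreasing while the
  sides are kept, \<open>k\<close> would reverse only the direction of the line.\<close>

lemma increasing_on_line:
  assumes cont: "continuous_on UNIV k" and bij: "bij k" and D: "ratio_log k D"
    and sides: "\<And>q. sgn (Im (k q) - b) = sgn (Im q - a)"
    and pq: "Im p = a" "Im q = a" "Re p < Re q"
  shows "Re (k p) < Re (k q)"
proof -
  define f where "f = (\<lambda>t. Re (k (Complex t a)))"
  have line: "Im (k z) = b" if "Im z = a" for z
    using sides[of z] that by (simp add: sgn_zero_iff)
  have fk: "Re (k z) = f (Re z)" if "Im z = a" for z
    unfolding f_def using that by (metis complex.collapse)
  have "continuous_on UNIV f" unfolding f_def Complex_eq
    by (intro continuous_intros continuous_on_compose2[OF cont]) auto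
  moreover have "inj f"
  proof (rule injI)
    fix s t assume "f s = f t"
    then have "k (Complex s a) = k (Complex t a)" unfolding f_def by (simp add: complex_eq_iff line)
    then show "s = t" using bij_is_inj[OF bij] by (auto simp: inj_eq)
  qed
  ultimately have "strict_mono f \<or> strict_antimono_on UNIV f"
    using injective_eq_monotone_map[of UNIV f] by auto
  moreover have False if anti: "strict_antimono_on UNIV f"
  \<comment> \<open>Here \<open>e = -1\<close>: the normal direction is kept and the direction of
    the line reversed.\<close>
  proof (rule no_half_reflection[OF D, of "-1" p])
    show "-1 * Im (k z - k p) < 0" if "Im p < Im z" for z
      using sides[of z] line[OF pq(1)] that pq(1) by (auto simp: sgn_if split: if_splits)
    show "-1 * Im (k z - k p) > 0" if "Im p > Im z" for z
      using sides[of z] line[OF pq(1)] that pq(1) by (auto simp: sgn_if split: if_splits)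
  qed (use anti pq(1) in \<open>auto simp: fk line monotone_on_def\<close>)
  ultimately show ?thesis using pq by (auto simp: fk strict_mono_def)
qed

text \<open>
  In the configuration space of pairs of distinct points, the pairs with \<open>p\<close> on one of the two
  lines and \<open>q\<close> off that line can all be joined through pairs whose direction \<open>q - p\<close> stays in the
  same open half-plane, or on the same horizontal ray, as its image. Only on the line at
  height 1 are both sides of \<open>p\<close> joined, by letting \<open>q\<close> pass to the right of \<open>p\<close>.
\<close>

lemma strip_preserving_log:
  assumes cont: "continuous_on UNIV k" and bij: "bij k" and D: "ratio_log k D"
    and s1: "\<And>q. sgn (Im (k q) - 1) = sgn (Im q - 1)"
    and s2: "\<And>q. sgn (Im (k q) - 2) = sgn (Im q - 2)"
  obtains r :: int where
    "\<And>p q. Im p = 1 \<and> Im q \<noteq> 1 \<or> Im p = 2 \<and> Im q \<noteq> 2 \<Longrightarrow> \<bar>Im (D (p, q)) - 2 * pi * r\<bar> < pi"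
proof -
  let ?R = "(\<lambda>x::complex\<times>complex. Re (snd x) - Re (fst x)) -` {0<..}"
  define C1 where "C1 = {p. Im p = 1} \<times> {q. Im q \<ge> 1} \<inter> ?R"
  define C2 where "C2 = {p. Im p = 1} \<times> {q. Im q \<le> 1} \<inter> ?R"
  define C3 where "C3 = {p. Im p = 1} \<times> {q. Im q > 1}"
  define C4 where "C4 = {p. Im p = 1} \<times> {q. Im q < 1}"
  define C5 where "C5 = ({p. Im p \<ge> 1} \<inter> {p. Im p \<le> 2}) \<times> {q. Im q > 2}"
  define C6 where "C6 = ({p. Im p \<ge> 1} \<inter> {p. Im p \<le> 2}) \<times> {q. Im q < 1}"
  define C7 where "C7 = {p. Im p = 2} \<times> {q. Im q < 2}"
  note Cs = C1_def C2_def C3_def C4_def C5_def C6_def C7_def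
  \<comment> \<open>\<open>C3\<close>, \<open>C4\<close>, \<open>C5\<close> and \<open>C7\<close>
    contain the required pairs. \<open>C1\<close> and \<open>C2\<close> link the two sides at height
    1, while \<open>C5\<close> and \<open>C6\<close> let \<open>p\<close> cross the closed strip
    with \<open>q\<close> above or below it.\<close>
  define E where "E = ((((((C1 \<union> C2) \<union> C3) \<union> C4) \<union> C5) \<union> C6) \<union> C7)"
  have R: "convex ?R"
    by (intro convex_linear_vimage linearI) (auto simp: algebra_simps)
  have L: "convex {p. Im p = c}" for c :: real
    using convex_Int[OF convex_halfspace_Im_ge[of c] convex_halfspace_Im_le[of c]]
    by (simp add: Int_def conj_commute order.antisym set_eq_iff eq_iff flip: Collect_conj_eq)
  have conv: "connected C1" "connected C2" "connected C3" "connected C4" "connected C5"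
    "connected C6" "connected C7"
    unfolding Cs
    by (intro convex_connected convex_Int convex_Times R L convex_halfspace_Im_ge
        convex_halfspace_Im_le convex_halfspace_Im_gt convex_halfspace_Im_lt)+
  \<comment> \<open>Each new convex piece shares one of these points with an earlier piece.\<close>
  have "(\<i>, \<i> + 1) \<in> C1 \<inter> C2" "(\<i>, 2 * \<i> + 1) \<in> C1 \<inter> C3" "(\<i>, 1) \<in> C2 \<inter> C4"
    "(\<i>, 3 * \<i>) \<in> C3 \<inter> C5" "(\<i>, 0) \<in> C4 \<inter> C6" "(2 * \<i>, 0) \<in> C6 \<inter> C7"
    unfolding Cs by auto
  then have E: "connected E" unfolding E_def by (intro connected_Un conv) blast+
  have ray: "exp (D (p, q)) \<notin> \<real>\<^sub>\<le>\<^sub>0" and ne: "p \<noteq> q" if "(p, q) \<in> E" for p q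
  proof -
    have inc: "Im p = 1 \<Longrightarrow> Im q = 1 \<Longrightarrow> Re p < Re q \<Longrightarrow> Re (k p) < Re (k q)"
      by (rule increasing_on_line[OF cont bij D s1])
    have E': "Im p < Im q \<and> Im (k p) < Im (k q) \<or> Im q < Im p \<and> Im (k q) < Im (k p) \<or>
        Im p = Im q \<and> Im (k p) = Im (k q) \<and> Re p < Re q \<and> Re (k p) < Re (k q)"
      using that s1[of p] s1[of q] s2[of p] s2[of q] inc unfolding E_def Cs
      by (auto simp: sgn_if split: if_splits)
    then show "p \<noteq> q" by auto
    then have "exp (D (p, q)) = (k q - k p) / (q - p)"
      using D unfolding ratio_log_def by simp
    also have "\<dots> \<notin> \<real>\<^sub>\<le>\<^sub>0" using E' by (intro ratio_avoids_nonpos_Reals) auto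
    finally show "exp (D (p, q)) \<notin> \<real>\<^sub>\<le>\<^sub>0" .
  qed
  have cD: "continuous_on E D"
    by (rule continuous_on_subset[of "{(p, q). p \<noteq> q}"]) (use D ne in \<open>auto simp: ratio_log_def\<close>)
  \<comment> \<open>On \<open>E\<close> the principal logarithm of the ratio is continuous, so the
    number \<open>r\<close> of full turns by which \<open>D\<close> exceeds it is the same for both
    lines.\<close>
  obtain r :: int where r: "\<And>x. x \<in> E \<Longrightarrow> D x = Ln (exp (D x)) + 2 * pi * r * \<i>"
  proof (rule continuous_logs_differ_by_constant[OF E cD])
    show "continuous_on E (\<lambda>x. Ln (exp (D x)))"
      using ray by (intro continuous_intros cD) auto
  qed auto
  have "\<bar>Im (D (p, q)) - 2 * pi * r\<bar> < pi"
    if "Im p = 1 \<and> Im q \<noteq> 1 \<or> Im p = 2 \<and> Im q \<noteq> 2" for p q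
  proof -
    have "(p, q) \<in> E" using that unfolding E_def Cs by auto
    from r[OF this] have "Im (D (p, q)) - 2 * pi * r = Im (Ln (exp (D (p, q))))"
      by (simp add: complex_eq_iff)
    then show ?thesis
      using Im_Ln_less_pi[OF ray[OF \<open>(p, q) \<in> E\<close>]] mpi_less_Im_Ln[of "exp (D (p, q))"] by auto
  qed
  then show ?thesis by (rule that)
qed

text \<open>Adding \<open>D\<close> to the logarithm for \<open>h\<close> gives a logarithm for
  \<open>h'\<close>, up to one constant on the connected space \<open>W \<F>\<close>. Over the two
  transversals the lifts agree modulo 4, and the bounds on the arguments leave only one possible
  multiple of 4.\<close>

lemma lift_difference:
  assumes F: "oriented_foliation \<F>"
    and h: "h \<in> Str \<Gamma>\<^sub>1 \<Gamma>\<^sub>2" and \<Theta>: "is_lift (image_foliation h \<F>) \<Theta>"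
    and h': "h' \<in> Str \<Gamma>\<^sub>1 \<Gamma>\<^sub>2" and \<Theta>': "is_lift (image_foliation h' \<F>) \<Theta>'"
    and trans: "positively_transverse \<Gamma>\<^sub>1 \<F>" "positively_transverse \<Gamma>\<^sub>2 \<F>"
  shows "\<exists>c. \<forall>x \<in> points \<Gamma>\<^sub>1 \<union> points \<Gamma>\<^sub>2. \<forall>x'. (x, x') \<in> W \<F> \<longrightarrow>
    \<Theta>' (h' x, h' x') - \<Theta> (h x, h x') = c"
proof -
  have op: "op_homeo h" "op_homeo h'"
    and im: "h ` points \<Gamma>\<^sub>1 = {z. Im z = 1}" "h ` points \<Gamma>\<^sub>2 = {z. Im z = 2}"
      "h' ` points \<Gamma>\<^sub>1 = {z. Im z = 1}" "h' ` points \<Gamma>\<^sub>2 = {z. Im z = 2}"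
    using h h' unfolding Str_def by auto
  have inj: "inj h" using op_homeo_bij[OF op(1)] by (rule bij_is_inj)
  define k where "k = h' \<circ> inv h"
  have kh: "k (h z) = h' z" for z unfolding k_def by (simp add: inj)
  obtain D where D: "ratio_log k D" unfolding k_def using ratio_log_compose_inv[OF op] .
  have bij: "bij k" unfolding k_def
    by (intro bij_comp op_homeo_bij op bij_imp_bij_inv)
  have cont: "continuous_on UNIV k" unfolding k_def
    by (intro continuous_on_compose op_homeo_cont op)
  have "k ` h ` A = h' ` A" for A by (simp add: image_image kh)
  then have line: "k ` {z. Im z = 1} = {z. Im z = 1}" "k ` {z. Im z = 2} = {z. Im z = 2}"
    using im by metis+
  have i2: "Im (k (2 * \<i>)) = 2" and i1: "Im (k \<i>) = 1" using line by force+
  \<comment> \<open>Swapping the sides of the line at height 1 would send height 2 below it, but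
    \<open>k\<close> preserves the line at height 2. The next claim is symmetric.\<close>
  have s1: "sgn (Im (k q) - 1) = sgn (Im q - 1)" for q
    using half_planes[OF cont bij line(1)]
  proof (elim disjE)
    assume "\<forall>q. sgn (Im (k q) - 1) = - sgn (Im q - 1)"
    from this[rule_format, of "2 * \<i>"] i2 show ?thesis by simp
  qed blast
  have s2: "sgn (Im (k q) - 2) = sgn (Im q - 2)" for q
    using half_planes[OF cont bij line(2)]
  proof (elim disjE)
    assume "\<forall>q. sgn (Im (k q) - 2) = - sgn (Im q - 2)"
    from this[rule_format, of \<i>] i1 show ?thesis by simp
  qed blast
  obtain r :: int where r: "\<And>p q. Im p = 1 \<and> Im q \<noteq> 1 \<or> Im p = 2 \<and> Im q \<noteq> 2 \<Longrightarrow>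
      \<bar>Im (D (p, q)) - 2 * pi * r\<bar> < pi"
    by (rule strip_preserving_log[OF cont bij D s1 s2]) (rule that, blast)
  obtain A where A: "continuous_on (W \<F>) A"
    "\<forall>(z, z') \<in> W \<F>. exp (A (z, z')) = h z' - h z"
    "\<forall>(z, z') \<in> W \<F>. \<bar>Im (A (z, z')) - \<Theta> (h z, h z') * pi / 2\<bar> < pi / 2"
    using lift_log[OF F op(1) \<Theta>] .
  obtain A' where A': "continuous_on (W \<F>) A'"
    "\<forall>(z, z') \<in> W \<F>. exp (A' (z, z')) = h' z' - h' z"
    "\<forall>(z, z') \<in> W \<F>. \<bar>Im (A' (z, z')) - \<Theta>' (h' z, h' z') * pi / 2\<bar> < pi / 2"
    using lift_log[OF F op(2) \<Theta>'] .
  have ne: "h z \<noteq> h z'" if "(z, z') \<in> W \<F>" for z z'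
    using that inj by (auto simp: W_def inj_eq)
  define B where "B = (\<lambda>x. A x + D (h (fst x), h (snd x)))"
  obtain m :: int where m: "\<And>x. x \<in> W \<F> \<Longrightarrow> A' x = B x + 2 * pi * m * \<i>"
  proof (rule continuous_logs_differ_by_constant[OF _ A'(1), of B])
    show "connected (W \<F>)" using connected_W[OF F connected_UNIV] by simp
    show "continuous_on (W \<F>) B" unfolding B_def using ne
      by (intro continuous_on_add A(1) ratio_log_continuous[OF D] continuous_intros
          continuous_on_compose2[OF op_homeo_cont(1)[OF op(1), of UNIV]]) auto
    show "exp (A' x) = exp (B x)" if "x \<in> W \<F>" for x
    proof -
      obtain z z' where x: "x = (z, z')" "(z, z') \<in> W \<F>" using \<open>x \<in> W \<F>\<close> by (cases x) auto
      have "k (h z') - k (h z) = (h z' - h z) * exp (D (h z, h z'))"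
        using D ne[OF x(2)] unfolding ratio_log_def by blast
      then show ?thesis unfolding x(1) B_def
        using bspec[OF A(2) x(2)] bspec[OF A'(2) x(2)] by (simp add: exp_add kh)
    qed
  qed blast
  show ?thesis
  proof (intro exI ballI allI impI)
    fix x x' assume x: "x \<in> points \<Gamma>\<^sub>1 \<union> points \<Gamma>\<^sub>2" and W: "(x, x') \<in> W \<F>"
    let ?n = "\<Theta> (h x, h x')" and ?n' = "\<Theta>' (h' x, h' x')"
    have off: "Im (h x) = 1 \<and> Im (h x') \<noteq> 1 \<or> Im (h x) = 2 \<and> Im (h x') \<noteq> 2"
      using x
    proof
      assume x1: "x \<in> points \<Gamma>\<^sub>1"
      then have "h x \<in> h ` points \<Gamma>\<^sub>1" "h x' \<notin> h ` points \<Gamma>\<^sub>1"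
        using W_not_on_transversal[OF F trans(1) x1 W] inj by (simp_all add: inj_image_mem_iff)
      then show ?thesis unfolding im by simp
    next
      assume x2: "x \<in> points \<Gamma>\<^sub>2"
      then have "h x \<in> h ` points \<Gamma>\<^sub>2" "h x' \<notin> h ` points \<Gamma>\<^sub>2"
        using W_not_on_transversal[OF F trans(2) x2 W] inj by (simp_all add: inj_image_mem_iff)
      then show ?thesis unfolding im by simp
    qed
    \<comment> \<open>Off the base line the class is decided by the side, which \<open>k\<close>
      preserves; so the two lifts differ by a multiple of 4.\<close>
    have "dot_theta (h' x) (h' x') horizontal_foliation = dot_theta (h x) (h x') horizontal_foliation"
      using off s1[of "h x"] s1[of "h x'"] s2[of "h x"] s2[of "h x'"]
      unfolding dot_theta_horizontal_foliation kh by (auto simp: sgn_if split: if_splits)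
    then have "(of_int ?n' :: 4) = of_int ?n"
      using pullback_lift(2)[OF F op(1) \<Theta> W] pullback_lift(2)[OF F op(2) \<Theta>' W] by simp
    then obtain j where j: "?n' - ?n = 4 * j" unfolding of_int_eq_mod_4 by blast
    have "Im (A' (x, x')) = Im (A (x, x')) + Im (D (h x, h x')) + 2 * pi * m"
      using m[OF W] by (simp add: B_def)
    moreover have "?n' * pi / 2 - ?n * pi / 2 = 2 * pi * j"
      using arg_cong[OF j, of real_of_int] by (simp add: field_simps)
    \<comment> \<open>The errors are below \<open>pi / 2\<close> for each of the two logarithms and
      below \<open>pi\<close> for \<open>D\<close>, hence below one full turn in total. The integer
      \<open>j - r - m\<close> must therefore vanish.\<close>
    ultimately have "\<bar>2 * pi * j - 2 * pi * r - 2 * pi * m\<bar> < 2 * pi"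
      using bspec[OF A(3) W] bspec[OF A'(3) W] r[OF off] unfolding prod.case by linarith
    also have "2 * pi * j - 2 * pi * r - 2 * pi * m = 2 * pi * real_of_int (j - r - m)"
      by (simp add: algebra_simps)
    finally have "\<bar>real_of_int (j - r - m)\<bar> < 1"
      by (simp add: abs_mult del: of_int_diff)
    then have "j = r + m" by linarith
    then show "?n' - ?n = 4 * (r + m)" using j by simp
  qed
qed

theorem proposition4p1:
  fixes \<F> :: "oline set" and \<Gamma>\<^sub>1 \<Gamma>\<^sub>2 :: oline
  assumes "oriented_foliation \<F>"
    and "oriented_line \<Gamma>\<^sub>1" and "oriented_line \<Gamma>\<^sub>2"
    and "points \<Gamma>\<^sub>1 \<inter> points \<Gamma>\<^sub>2 = {}"
    and "positively_transverse \<Gamma>\<^sub>1 \<F>" and "positively_transverse \<Gamma>\<^sub>2 \<F>"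
  shows "\<exists>n::int. \<forall>h \<in> Str \<Gamma>\<^sub>1 \<Gamma>\<^sub>2. \<forall>\<Theta>. is_lift (image_foliation h \<F>) \<Theta> \<longrightarrow>
           (\<forall>x\<^sub>1 \<in> points \<Gamma>\<^sub>1. \<forall>x\<^sub>1' \<in> pos_half_leaf \<F> x\<^sub>1 - {x\<^sub>1}.
            \<forall>x\<^sub>2 \<in> points \<Gamma>\<^sub>2. \<forall>x\<^sub>2' \<in> pos_half_leaf \<F> x\<^sub>2 - {x\<^sub>2}.
              \<Theta> (h x\<^sub>2, h x\<^sub>2') - \<Theta> (h x\<^sub>1, h x\<^sub>1') = n)"
proof -
  define P where "P = (\<lambda>h \<Theta> x\<^sub>1 x\<^sub>1' x\<^sub>2 x\<^sub>2'.
    h \<in> Str \<Gamma>\<^sub>1 \<Gamma>\<^sub>2 \<and> is_lift (image_foliation h \<F>) \<Theta> \<and> x\<^sub>1 \<in> points \<Gamma>\<^sub>1 \<and> (x\<^sub>1, x\<^sub>1') \<in> W \<F> \<and>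
    x\<^sub>2 \<in> points \<Gamma>\<^sub>2 \<and> (x\<^sub>2, x\<^sub>2') \<in> W \<F>)"
  \<comment> \<open>The points are changed first, with \<open>h\<close> and \<open>\<Theta>\<close>
    fixed, by constancy along each transversal. Then \<open>h\<close> and \<open>\<Theta>\<close>
    are changed with the points fixed; this adds the same \<open>c\<close> on both transversals,
    which cancels in the difference.\<close>
  have indep: "\<Theta>' (h' y\<^sub>2, h' y\<^sub>2') - \<Theta>' (h' y\<^sub>1, h' y\<^sub>1') = \<Theta> (h x\<^sub>2, h x\<^sub>2') - \<Theta> (h x\<^sub>1, h x\<^sub>1')"
    if "P h \<Theta> x\<^sub>1 x\<^sub>1' x\<^sub>2 x\<^sub>2'" "P h' \<Theta>' y\<^sub>1 y\<^sub>1' y\<^sub>2 y\<^sub>2'"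
    for h \<Theta> x\<^sub>1 x\<^sub>1' x\<^sub>2 x\<^sub>2' h' \<Theta>' y\<^sub>1 y\<^sub>1' y\<^sub>2 y\<^sub>2'
  proof -
    from that have h: "h \<in> Str \<Gamma>\<^sub>1 \<Gamma>\<^sub>2" "is_lift (image_foliation h \<F>) \<Theta>"
      and h': "h' \<in> Str \<Gamma>\<^sub>1 \<Gamma>\<^sub>2" "is_lift (image_foliation h' \<F>) \<Theta>'"
      and x: "x\<^sub>1 \<in> points \<Gamma>\<^sub>1" "(x\<^sub>1, x\<^sub>1') \<in> W \<F>" "x\<^sub>2 \<in> points \<Gamma>\<^sub>2" "(x\<^sub>2, x\<^sub>2') \<in> W \<F>"
      and y: "y\<^sub>1 \<in> points \<Gamma>\<^sub>1" "(y\<^sub>1, y\<^sub>1') \<in> W \<F>" "y\<^sub>2 \<in> points \<Gamma>\<^sub>2" "(y\<^sub>2, y\<^sub>2') \<in> W \<F>"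
      unfolding P_def by blast+
    have op: "op_homeo h" "h ` points \<Gamma>\<^sub>1 = {z. Im z = 1}" "h ` points \<Gamma>\<^sub>2 = {z. Im z = 2}"
      using h(1) unfolding Str_def by auto
    obtain c where c: "\<forall>x \<in> points \<Gamma>\<^sub>1 \<union> points \<Gamma>\<^sub>2. \<forall>x'. (x, x') \<in> W \<F> \<longrightarrow>
        \<Theta>' (h' x, h' x') - \<Theta> (h x, h x') = c"
      using lift_difference[OF assms(1) h h' assms(5,6)] ..
    have "\<Theta> (h x\<^sub>1, h x\<^sub>1') = \<Theta> (h y\<^sub>1, h y\<^sub>1')" "\<Theta> (h x\<^sub>2, h x\<^sub>2') = \<Theta> (h y\<^sub>2, h y\<^sub>2')"
      using lift_constant_on_transversal[OF assms(1) op(1) h(2) assms(2,5) op(2) x(1,2) y(1,2)]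
        lift_constant_on_transversal[OF assms(1) op(1) h(2) assms(3,6) op(3) x(3,4) y(3,4)] .
    then show ?thesis using c[rule_format, of y\<^sub>1 y\<^sub>1'] c[rule_format, of y\<^sub>2 y\<^sub>2'] y by simp
  qed
  have "\<exists>n. \<forall>h \<Theta> x\<^sub>1 x\<^sub>1' x\<^sub>2 x\<^sub>2'. P h \<Theta> x\<^sub>1 x\<^sub>1' x\<^sub>2 x\<^sub>2' \<longrightarrow> \<Theta> (h x\<^sub>2, h x\<^sub>2') - \<Theta> (h x\<^sub>1, h x\<^sub>1') = n"
  \<comment> \<open>One admissible choice supplies the integer; when there is none, any integer
    serves.\<close>
  proof (cases "\<exists>h \<Theta> x\<^sub>1 x\<^sub>1' x\<^sub>2 x\<^sub>2'. P h \<Theta> x\<^sub>1 x\<^sub>1' x\<^sub>2 x\<^sub>2'")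
    case True
    then obtain h \<Theta> x\<^sub>1 x\<^sub>1' x\<^sub>2 x\<^sub>2' where P: "P h \<Theta> x\<^sub>1 x\<^sub>1' x\<^sub>2 x\<^sub>2'" by blast
    show ?thesis
      by (intro exI[of _ "\<Theta> (h x\<^sub>2, h x\<^sub>2') - \<Theta> (h x\<^sub>1, h x\<^sub>1')"] allI impI) (rule indep[OF P])
  qed blast
  then obtain n where "\<And>h \<Theta> x\<^sub>1 x\<^sub>1' x\<^sub>2 x\<^sub>2'.
      P h \<Theta> x\<^sub>1 x\<^sub>1' x\<^sub>2 x\<^sub>2' \<Longrightarrow> \<Theta> (h x\<^sub>2, h x\<^sub>2') - \<Theta> (h x\<^sub>1, h x\<^sub>1') = n" by blast
  then show ?thesis unfolding P_def W_def by (intro exI[of _ n] ballI allI impI) auto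
qed

end
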